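(* Let $L=\mathbb{Z}\alpha$ be a rank one negative definite even lattice, $\langle\alpha,\alpha\rangle=-2k$ with $k\in\mathbb{Z}_{>0}$. Then $V_L^+=C_2(V_L^+)$; in particular $V_L^+$ satisfies the $C_2$-cofiniteness condition and $V_L^+/C_2(V_L^+)=0$.
   Context: Let $L$ be an even lattice with non-degenerate form $\langle\cdot,\cdot\rangle$, $\mathfrak{h}=\mathbb{C}\otimes_{\mathbb{Z}}L$, $M(1)$ the Heisenberg vertex algebra on $\mathfrak{h}$, and $V_L=M(1)\otimes\mathbb{C}[L]$ the lattice vertex algebra (a $\mathbb{Z}$-graded vertex algebra with conformal vector $\omega=\frac12\sum_ih_i(-1)^2\mathbf{1}$, $\{h_i\}$ an orthonormal basis of $\mathfrak{h}$). Let $\theta$ be the automorphism of $V_L$ given by $\theta(\beta_1(-n_1)\cdots\beta_r(-n_r)e^\beta)=(-1)^r\beta_1(-n_1)\cdots\beta_r(-n_r)e^{-\beta}$, and $V_L^+$ its fixed-point vertex subalgebra. $C_2(V)=\mathrm{Span}_{\mathbb{C}}\{u_{-2}v\mid u,v\in V\}$ with $Y(u,z)=\sum_nu_nz^{-n-1}$; $V$ satisfies the $C_2$-cofiniteness condition if $\dim V/C_2(V)<\infty$. *)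

theory Defs
  imports Complex_Main "HOL-Library.Multiset" "HOL-Library.Poly_Mapping"
begin

text \<open>Rank one lattice L = Z alpha with <alpha,alpha> = N (here N = -2k).
  M(1) is realised as the polynomial ring in variables x_m = alpha(-m), m >= 1,
  i.e. a monomial alpha(-m_1)...alpha(-m_r) 1 is the multiset {m_1,...,m_r}.
  V_L = M(1) (x) C[L] has basis (mu, c) <-> alpha(-mu) e^{c alpha}.\<close>

type_synonym m1 = "nat multiset \<Rightarrow>\<^sub>0 complex"
type_synonym vl = "(nat multiset \<times> int) \<Rightarrow>\<^sub>0 complex"

definition cscale :: "complex \<Rightarrow> ('a \<Rightarrow>\<^sub>0 complex) \<Rightarrow> ('a \<Rightarrow>\<^sub>0 complex)" where
  "cscale c f = Poly_Mapping.map (\<lambda>x. c * x) f"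

definition mono :: "nat multiset \<Rightarrow> m1" where
  "mono \<mu> = Poly_Mapping.single \<mu> 1"

definition xvar :: "nat \<Rightarrow> m1" where
  "xvar m = mono {#m#}"

definition cnst :: "complex \<Rightarrow> m1" where
  "cnst a = Poly_Mapping.single {#} a"

definition lin_ext :: "(nat multiset \<Rightarrow> m1) \<Rightarrow> m1 \<Rightarrow> m1" where
  "lin_ext F f = (\<Sum>\<mu>\<in>Poly_Mapping.keys f. cscale (Poly_Mapping.lookup f \<mu>) (F \<mu>))"

definition wproj :: "int \<Rightarrow> m1 \<Rightarrow> m1" where
  "wproj W f = (\<Sum>\<mu>\<in>{\<mu>\<in>Poly_Mapping.keys f. int (sum_mset \<mu>) = W}. Poly_Mapping.single \<mu> (Poly_Mapping.lookup f \<mu>))"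

text \<open>The annihilation part of the field (1/(n-1)!) d^{n-1}/dz^{n-1} alpha(z) at z = 1,
  acting on M(1) (x) e^{c alpha}:
  sum_{m>=0} binom(-m-1,n-1) alpha(m), where alpha(0) = N c and alpha(m) = m N d/dx_m.\<close>
definition ann_op :: "int \<Rightarrow> int \<Rightarrow> nat \<Rightarrow> m1 \<Rightarrow> m1" where
  "ann_op N c n = lin_ext (\<lambda>\<rho>.
      cscale (((-1::complex) gchoose (n - 1)) * of_int N * of_int c) (mono \<rho>)
    + (\<Sum>m\<in>{m\<in>set_mset \<rho>. 1 \<le> m}.
         cscale (((- of_nat m - 1 :: complex) gchoose (n - 1)) * of_nat m * of_int N
                  * of_nat (count \<rho> m)) (mono (\<rho> - {#m#}))))"

text \<open>E^+(-beta,z) at z = 1 for beta = b alpha: the substitution x_m \<mapsto> x_m - b N\<close>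
definition shift_op :: "int \<Rightarrow> int \<Rightarrow> m1 \<Rightarrow> m1" where
  "shift_op N b = lin_ext (\<lambda>\<rho>. prod_mset (image_mset (\<lambda>m. xvar m + cnst (- of_int (N * b))) \<rho>))"

text \<open>creation part of (1/(n-1)!) d^{n-1}/dz^{n-1} alpha(z) at z = 1 (truncated at weight W):
  sum_{m>=1} binom(m-1,n-1) alpha(-m)\<close>
definition cre_op :: "nat \<Rightarrow> nat \<Rightarrow> m1" where
  "cre_op n W = (\<Sum>m\<in>{1..W}. cscale (of_nat ((m - 1) choose (n - 1))) (xvar m))"

text \<open>E^-(-beta,z) = exp(sum_{m>0} beta(-m) z^m / m) at z = 1, truncated at weight W\<close>
definition exp_op :: "int \<Rightarrow> nat \<Rightarrow> m1" where
  "exp_op b W = (\<Sum>j\<in>{0..W}. cscale (1 / of_nat (fact j))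
        ((\<Sum>m\<in>{1..W}. cscale (of_int b / of_nat m) (xvar m)) ^ j))"

definition embed :: "m1 \<Rightarrow> int \<Rightarrow> vl" where
  "embed P d = (\<Sum>l\<in>Poly_Mapping.keys P. Poly_Mapping.single (l, d) (Poly_Mapping.lookup P l))"

text \<open>Mode u_p v for basis vectors u = alpha(-n_1)...alpha(-n_r) e^{b alpha},
  v = alpha(-nu) e^{c alpha}: the coefficient of z^{-p-1} in
  Y(u,z) v = :prod_i (1/(n_i-1)!) d^{n_i-1}alpha(z) Y(e^{b alpha},z): v, where
  Y(e^beta,z) = E^-(-beta,z) E^+(-beta,z) e_beta z^{beta(0)} (trivial cocycle).
  The normal ordered product splits each alpha field into its creation part
  (positions in S, to the left) and its annihilation part (incl. alpha(0);
  positions not in S, to the right of e_beta z^{beta(0)}).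
  The power of z of each term is determined by the Heisenberg weight of the output
  monomial, so the coefficient of z^{-p-1} is the weight projection below.\<close>
definition modeB :: "int \<Rightarrow> nat multiset \<times> int \<Rightarrow> int \<Rightarrow> nat multiset \<times> int \<Rightarrow> vl" where
  "modeB N u p v = (case u of (\<mu>, b) \<Rightarrow> case v of (\<nu>, c) \<Rightarrow>
     (let ns = sorted_list_of_multiset \<mu>;
          r = length ns;
          Wi = int (sum_mset \<nu>) + int (sum_mset \<mu>) - N * b * c - p - 1;
          W = nat Wi
      in if Wi < 0 then 0 else
        (\<Sum>S\<in>Pow {..<r}.
           embed (wproj Wi
              ((\<Prod>i\<in>S. cre_op (ns ! i) W) * exp_op b W *
               shift_op N b (foldr (\<lambda>i f. ann_op N c (ns ! i) f)
                                   (filter (\<lambda>i. i \<notin> S) [0..<r]) (mono \<nu>))))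
           (b + c))))"

definition mode :: "int \<Rightarrow> vl \<Rightarrow> int \<Rightarrow> vl \<Rightarrow> vl" where
  "mode N u p v = (\<Sum>a\<in>Poly_Mapping.keys u. \<Sum>a'\<in>Poly_Mapping.keys v. cscale (Poly_Mapping.lookup u a * Poly_Mapping.lookup v a') (modeB N a p a'))"

definition VL :: "vl set" where
  "VL = {v. \<forall>x\<in>Poly_Mapping.keys v. 0 \<notin># fst x}"

definition theta :: "vl \<Rightarrow> vl" where
  "theta v = (\<Sum>x\<in>Poly_Mapping.keys v. Poly_Mapping.single (fst x, - snd x)
                  ((-1) ^ size (fst x) * Poly_Mapping.lookup v x))"

definition VLplus :: "vl set" where
  "VLplus = {v\<in>VL. theta v = v}"

definition C2 :: "int \<Rightarrow> vl set \<Rightarrow> vl set" where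
  "C2 N V = {x. \<exists>(n::nat) c u w. (\<forall>i<n. u i \<in> V \<and> w i \<in> V) \<and>
                 x = (\<Sum>i<n. cscale (c i) (mode N (u i) (-2) (w i)))}"

end

theory Submission
  imports Defs "HOL-Computational_Algebra.Polynomial"
begin

text \<open>
  Write $F(v) = v + \theta v$ and $x_m = \alpha(-m)$. For $M > 0$ the elements $F(P e^{M\alpha})$ with $P$ of
  Heisenberg weight at least $5$ lie in $C_2(V_L^+)$: the quadratic vectors $x_i x_j$ give
  $(i x_{i+1} x_j + j x_i x_{j+1}) P \equiv 0$ up to shorter monomials, translation $u_{-2}\mathbf{1}$ removes
  every monomial containing $x_1$, so everything reduces to $x_w$, and the relations of length at most three force
  $x_w \equiv 0$ because $\langle\alpha,\alpha\rangle < 0$.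

  Now take the $(-2)$-product of $F(x_n e^{m\alpha})$ with $F(Q e^{(m+b)\alpha})$, where $n = 2km(m+b) - 1$ is chosen
  so that the component of charge $b$ has the weight of $Q$. Since the form is negative definite, the component of
  charge $2m+b$ has large weight and is in $C_2$ by the first step, hence so is the component of charge $b$. Up to a
  nonzero factor it is a polynomial in $m$, so all of its coefficients are in $C_2$; the lowest one that does not
  vanish is a nonzero multiple of $F(Q e^{b\alpha})$.
\<close>

section \<open>Linear maps between spaces of finitely supported functions\<close>

text \<open>The first step divides by M and by a multiple of M N, so it says nothing in charge 0,
  and it misses small weights; the extreme case is the vacuum. With nonnegative conformal weights
  u_{-2}v could never have weight 0. Here e^{m\<alpha>} has weight -k m^2, so the very negative
  weight of Q e^{(m+b)\<alpha>} absorbs the weight of \<alpha>(-n) e^{-m\<alpha>}. Both components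
  of the product have the same conformal weight, hence the one of charge 2m+b carries Heisenberg
  weight \<open>sum_mset Q\<close> + 4 k m (m+b), outside the exceptional range for large m. The
  integer m is a free parameter: it changes the factors but neither the charge b nor the weight of
  the component that is kept. For large m the number n exceeds the weight of Q, so the field of
  \<alpha>(-n) has no creation part there, and rewriting binom(-i-1, n-1) as (-1)^(n-1) binom(n-1+i,
  i) makes its annihilation coefficients polynomial in m up to a common sign.\<close>

lemma lookup_cscale [simp]: "Poly_Mapping.lookup (cscale c f) x = c * Poly_Mapping.lookup f x"
  by (simp add: cscale_def Poly_Mapping.map.rep_eq when_def)

lemma cscale_add: "cscale c (f + g) = cscale c f + cscale c g"
  by (rule poly_mapping_eqI) (simp add: lookup_add algebra_simps)

lemma cscale_add_left: "cscale (c + d) f = cscale c f + cscale d f"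
  by (rule poly_mapping_eqI) (simp add: lookup_add algebra_simps)

lemma cscale_cscale [simp]: "cscale c (cscale d f) = cscale (c * d) f"
  by (rule poly_mapping_eqI) simp

lemma cscale_zero [simp]: "cscale c 0 = 0" "cscale 0 f = 0"
  by (rule poly_mapping_eqI, simp)+

lemma cscale_one [simp]: "cscale 1 f = f"
  by (rule poly_mapping_eqI) simp

lemma cscale_single [simp]: "cscale c (Poly_Mapping.single x d) = Poly_Mapping.single x (c * d)"
  by (rule poly_mapping_eqI) (simp add: lookup_single when_def)

lemma cscale_minus_one: "cscale (- 1) f = - f"
  by (rule poly_mapping_eqI) simp

lemma cscale_sum: "cscale c (sum f A) = (\<Sum>x\<in>A. cscale c (f x))"
  by (induction A rule: infinite_finite_induct) (auto simp: cscale_add)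

definition clin :: "(('a \<Rightarrow>\<^sub>0 complex) \<Rightarrow> ('b \<Rightarrow>\<^sub>0 complex)) \<Rightarrow> bool" where
  "clin f \<longleftrightarrow> (\<forall>x y. f (x + y) = f x + f y) \<and> (\<forall>c x. f (cscale c x) = cscale c (f x))"

lemma clinI:
  assumes "\<And>x y. f (x + y) = f x + f y" "\<And>c x. f (cscale c x) = cscale c (f x)"
  shows "clin f"
  using assms by (auto simp: clin_def)

lemma clin_add: "clin f \<Longrightarrow> f (x + y) = f x + f y"
  and clin_cscale: "clin f \<Longrightarrow> f (cscale c x) = cscale c (f x)"
  by (auto simp: clin_def)

lemma clin_0: "clin f \<Longrightarrow> f 0 = 0"
  using clin_cscale[of f 0 0] by simp

lemma clin_minus: "clin f \<Longrightarrow> f (- x) = - f x"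
  using clin_cscale[of f "- 1" x] by (simp add: cscale_minus_one)

lemma clin_sum: "clin f \<Longrightarrow> f (sum g A) = (\<Sum>x\<in>A. f (g x))"
  by (induction A rule: infinite_finite_induct) (auto simp: clin_0 clin_add)

lemma clin_comp: "clin f \<Longrightarrow> clin g \<Longrightarrow> clin (\<lambda>x. f (g x))"
  by (auto simp: clin_def)

lemma clin_cmul: "clin f \<Longrightarrow> clin (\<lambda>x. cscale c (f x))"
  by (auto simp: clin_def cscale_add mult.commute)

lemma clin_plus: "clin f \<Longrightarrow> clin g \<Longrightarrow> clin (\<lambda>x. f x + g x)"
  by (auto simp: clin_def cscale_add)

lemma clin_zero: "clin (\<lambda>x. 0)"
  by (auto simp: clin_def)

lemma clin_id: "clin (\<lambda>x. x)"
  by (auto simp: clin_def)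

lemma clin_setsum: "(\<And>a. a \<in> A \<Longrightarrow> clin (f a)) \<Longrightarrow> clin (\<lambda>x. \<Sum>a\<in>A. f a x)"
  by (induction A rule: infinite_finite_induct) (auto intro: clin_plus clin_zero)

text \<open>\<open>lin_ext\<close>, \<open>wproj\<close>, \<open>embed\<close>, \<open>theta\<close>
  and \<open>mode\<close> are all sums over the support of their argument. Written as
  \<open>linex\<close> they are linear at once, and identities between them need checking on basis
  vectors only.\<close>

definition linex :: "('a \<Rightarrow> ('b \<Rightarrow>\<^sub>0 complex)) \<Rightarrow> ('a \<Rightarrow>\<^sub>0 complex) \<Rightarrow> ('b \<Rightarrow>\<^sub>0 complex)" where
  "linex F f = (\<Sum>x\<in>Poly_Mapping.keys f. cscale (Poly_Mapping.lookup f x) (F x))"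

lemma linex_superset:
  assumes "finite A" "Poly_Mapping.keys f \<subseteq> A"
  shows "linex F f = (\<Sum>x\<in>A. cscale (Poly_Mapping.lookup f x) (F x))"
  unfolding linex_def using assms
  by (intro sum.mono_neutral_left) (auto simp: in_keys_iff)

lemma clin_linex: "clin (linex F)"
proof (rule clinI)
  fix x y :: "'a \<Rightarrow>\<^sub>0 complex" and c
  let ?A = "Poly_Mapping.keys x \<union> Poly_Mapping.keys y"
  have *: "finite ?A" by simp
  have "Poly_Mapping.keys (x + y) \<subseteq> ?A" by (rule Poly_Mapping.keys_add)
  then show "linex F (x + y) = linex F x + linex F y"
    using linex_superset[OF *, of _ F]
    by (simp add: lookup_add cscale_add_left sum.distrib)
  have "Poly_Mapping.keys (cscale c x) \<subseteq> Poly_Mapping.keys x"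
    by (auto simp: in_keys_iff)
  then show "linex F (cscale c x) = cscale c (linex F x)"
    using linex_superset[of "Poly_Mapping.keys x" _ F] by (simp add: cscale_sum)
qed

lemma linex_single [simp]: "linex F (Poly_Mapping.single x c) = cscale c (F x)"
  using linex_superset[of "{x}" "Poly_Mapping.single x c" F] by simp

lemma linex_singles: "linex (\<lambda>x. Poly_Mapping.single x 1) f = f"
proof (rule poly_mapping_eqI)
  fix y
  have "Poly_Mapping.lookup (linex (\<lambda>x. Poly_Mapping.single x 1) f) y =
    (\<Sum>x\<in>Poly_Mapping.keys f. if x = y then Poly_Mapping.lookup f x else 0)"
    by (simp add: linex_def lookup_sum lookup_single when_def)
  also have "\<dots> = Poly_Mapping.lookup f y"
    by (auto simp: in_keys_iff)
  finally show "Poly_Mapping.lookup (linex (\<lambda>x. Poly_Mapping.single x 1) f) y = Poly_Mapping.lookup f y" .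
qed

lemma clin_expand:
  assumes "clin g"
  shows "g f = linex (\<lambda>x. g (Poly_Mapping.single x 1)) f"
proof -
  have "g f = g (linex (\<lambda>x. Poly_Mapping.single x 1) f)"
    by (simp add: linex_singles)
  also have "\<dots> = linex (\<lambda>x. g (Poly_Mapping.single x 1)) f"
    unfolding linex_def by (simp only: clin_sum[OF assms] clin_cscale[OF assms])
  finally show ?thesis .
qed

text \<open>Testing only basis vectors in the support of \<open>f\<close> lets homogeneity or a
  weight bound on \<open>f\<close> enter the comparison.\<close>

lemma clin_eq_on:
  assumes "clin g" "clin h"
    and "\<And>x. x \<in> Poly_Mapping.keys f \<Longrightarrow> g (Poly_Mapping.single x 1) = h (Poly_Mapping.single x 1)"
  shows "g f = h f"
  using assms by (subst (1 2) clin_expand) (auto simp: linex_def)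

section \<open>Subspaces and spans of basis vectors\<close>

definition csub :: "('a \<Rightarrow>\<^sub>0 complex) set \<Rightarrow> bool" where
  "csub K \<longleftrightarrow> 0 \<in> K \<and> (\<forall>x\<in>K. \<forall>y\<in>K. x + y \<in> K) \<and> (\<forall>c. \<forall>x\<in>K. cscale c x \<in> K)"

lemma csub_0: "csub K \<Longrightarrow> 0 \<in> K"
  and csub_add: "csub K \<Longrightarrow> x \<in> K \<Longrightarrow> y \<in> K \<Longrightarrow> x + y \<in> K"
  and csub_cscale: "csub K \<Longrightarrow> x \<in> K \<Longrightarrow> cscale c x \<in> K"
  by (auto simp: csub_def)

lemma csub_diff: "csub K \<Longrightarrow> x \<in> K \<Longrightarrow> y \<in> K \<Longrightarrow> x - y \<in> K"
  using csub_add[of K x "cscale (- 1) y"] csub_cscale[of K y "- 1"] by (simp add: cscale_minus_one)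

lemma csub_sum: "csub K \<Longrightarrow> (\<And>x. x \<in> A \<Longrightarrow> f x \<in> K) \<Longrightarrow> sum f A \<in> K"
  by (induction A rule: infinite_finite_induct) (auto simp: csub_0 csub_add)

lemma csub_cscale_cancel:
  assumes "csub K" "cscale c x \<in> K" "c \<noteq> 0"
  shows "x \<in> K"
  using csub_cscale[OF assms(1,2), of "inverse c"] assms(3) by simp

lemma csub_linex:
  "csub K \<Longrightarrow> (\<And>x. x \<in> Poly_Mapping.keys f \<Longrightarrow> F x \<in> K) \<Longrightarrow> linex F f \<in> K"
  unfolding linex_def by (auto intro!: csub_sum csub_cscale)

lemma csub_clin_image:
  "csub K \<Longrightarrow> clin g \<Longrightarrow> (\<And>x. x \<in> Poly_Mapping.keys f \<Longrightarrow> g (Poly_Mapping.single x 1) \<in> K) \<Longrightarrow> g f \<in> K"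
  by (subst clin_expand) (auto intro!: csub_linex)

lemma csub_vimage: "csub K \<Longrightarrow> clin g \<Longrightarrow> csub {x. g x \<in> K}"
  by (auto simp: csub_def clin_0 clin_add clin_cscale)

definition supp :: "'a set \<Rightarrow> ('a \<Rightarrow>\<^sub>0 complex) set" where
  "supp A = {f. Poly_Mapping.keys f \<subseteq> A}"

lemma supp_keysD: "f \<in> supp A \<Longrightarrow> x \<in> Poly_Mapping.keys f \<Longrightarrow> x \<in> A"
  by (auto simp: supp_def)

lemma csub_supp: "csub (supp A)"
proof -
  have "x + y \<in> supp A" if "x \<in> supp A" "y \<in> supp A" for x y :: "'a \<Rightarrow>\<^sub>0 complex"
    using that Poly_Mapping.keys_add[of x y] by (auto simp: supp_def)
  moreover have "cscale c x \<in> supp A" if "x \<in> supp A" for c x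
    using that by (auto simp: supp_def in_keys_iff)
  ultimately show ?thesis by (auto simp: csub_def) (simp add: supp_def)
qed

lemma supp_mono: "A \<subseteq> B \<Longrightarrow> f \<in> supp A \<Longrightarrow> f \<in> supp B"
  by (auto simp: supp_def)

lemma supp_single: "x \<in> A \<Longrightarrow> Poly_Mapping.single x c \<in> supp A"
  by (auto simp: supp_def)

lemma supp_mult:
  fixes f g :: m1
  assumes "f \<in> supp A" "g \<in> supp B" "\<And>a b. a \<in> A \<Longrightarrow> b \<in> B \<Longrightarrow> a + b \<in> C"
  shows "f * g \<in> supp C"
proof -
  have "x \<in> C" if xk: "x \<in> Poly_Mapping.keys (f * g)" for x
  proof -
    obtain a b where "x = a + b" "a \<in> Poly_Mapping.keys f" "b \<in> Poly_Mapping.keys g"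
      using xk keys_mult[of f g] by blast
    then show ?thesis using assms by (auto simp: supp_def)
  qed
  then show ?thesis by (auto simp: supp_def)
qed

lemma supp_one: "{#} \<in> A \<Longrightarrow> (1 :: m1) \<in> supp A"
  by (simp add: supp_def single_one[symmetric] zero_multiset_def del: single_one)

lemma supp_prod:
  fixes f :: "'i \<Rightarrow> m1"
  assumes "\<And>i. i \<in> I \<Longrightarrow> f i \<in> supp A" "{#} \<in> A" "\<And>a b. a \<in> A \<Longrightarrow> b \<in> A \<Longrightarrow> a + b \<in> A"
  shows "prod f I \<in> supp A"
  using assms(1)
  by (induction I rule: infinite_finite_induct)
     (auto intro: supp_mult[where A = A and B = A] assms(2,3) supp_one)

section \<open>The Heisenberg polynomial ring\<close>

text \<open>Scalars become ring elements, so that ring normalisation can collect them.\<close>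

lemma cscale_m1: "cscale c (f :: m1) = cnst c * f"
proof -
  have "cnst c * linex (\<lambda>x. Poly_Mapping.single x 1) f = cscale c (linex (\<lambda>x. Poly_Mapping.single x 1) f)"
    by (simp add: linex_def cscale_sum sum_distrib_left cnst_def mult_single)
  then show ?thesis by (simp add: linex_singles)
qed

lemma cnst_add: "cnst (a + b) = cnst a + cnst b"
  and cnst_minus: "cnst (- a) = - cnst a"
  and cnst_mult: "cnst (a * b) = cnst a * cnst b"
  and cnst_0 [simp]: "cnst 0 = 0"
  and cnst_1 [simp]: "cnst 1 = 1"
  by (simp_all add: cnst_def single_add single_uminus mult_single single_one zero_multiset_def[symmetric])

lemma cnst_of_nat: "cnst (of_nat n) = of_nat n"
  by (induction n) (auto simp: cnst_add)

lemma cnst_numeral: "cnst (numeral k) = numeral k"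
  using cnst_of_nat[of "numeral k"] by simp

lemma cnst_power: "cnst (a ^ n) = cnst a ^ n"
  by (induction n) (auto simp: cnst_mult)

lemma mono_empty [simp]: "mono {#} = 1"
  by (simp add: mono_def single_one zero_multiset_def[symmetric])

lemma mono_plus: "mono (\<mu> + \<nu>) = mono \<mu> * mono \<nu>"
  by (simp add: mono_def mult_single)

lemma mono_add_mset: "mono (add_mset m \<mu>) = xvar m * mono \<mu>"
  using mono_plus[of "{#m#}" \<mu>] by (simp add: xvar_def)

lemma single_eq_mono: "Poly_Mapping.single \<mu> c = cscale c (mono \<mu>)"
  by (simp add: mono_def)

lemma clin_mult_left: "clin (\<lambda>f :: m1. f * g)"
  by (rule clinI) (simp_all add: cscale_m1 algebra_simps)

lemma clin_mult_right: "clin (\<lambda>f :: m1. g * f)"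
  by (rule clinI) (simp_all add: cscale_m1 algebra_simps)

lemma lin_ext_eq_linex: "lin_ext F = linex F"
  by (rule ext) (simp add: lin_ext_def linex_def)

lemma embed_eq_linex: "embed P d = linex (\<lambda>l. Poly_Mapping.single (l, d) 1) P"
  by (simp add: embed_def linex_def)

lemma theta_eq_linex: "theta = linex (\<lambda>x. Poly_Mapping.single (fst x, - snd x) ((-1) ^ size (fst x)))"
  by (rule ext) (simp add: theta_def linex_def mult.commute)

lemma wproj_eq_linex: "wproj W = linex (\<lambda>\<mu>. if int (sum_mset \<mu>) = W then mono \<mu> else 0)"
  by (rule ext)
     (simp add: wproj_def linex_def mono_def sum.inter_filter[symmetric] if_distrib[where f = "cscale _"] cong: if_cong)

lemma mode_eq_linex: "mode N u p v = linex (\<lambda>a. linex (modeB N a p) v) u"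
  by (simp add: mode_def linex_def cscale_sum)

lemma clin_embed: "clin (\<lambda>P. embed P d)"
  unfolding embed_eq_linex by (rule clin_linex)

lemma clin_theta: "clin theta"
  unfolding theta_eq_linex by (rule clin_linex)

lemma clin_wproj: "clin (wproj W)"
  unfolding wproj_eq_linex by (rule clin_linex)

lemma clin_ann_op: "clin (ann_op N c n)"
  unfolding ann_op_def lin_ext_eq_linex by (rule clin_linex)

lemma clin_shift_op: "clin (shift_op N b)"
  unfolding shift_op_def lin_ext_eq_linex by (rule clin_linex)

lemma clin_mode_left: "clin (\<lambda>u. mode N u p v)"
  unfolding mode_eq_linex by (rule clin_linex)

lemma clin_linex_param: "clin (\<lambda>v. linex (\<lambda>a. linex (G a) v) u)"
  unfolding linex_def[of _ u] by (intro clin_setsum clin_cmul clin_linex)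

lemma clin_mode_right: "clin (\<lambda>v. mode N u p v)"
  unfolding mode_eq_linex by (rule clin_linex_param)

lemma mode_single:
  "mode N (Poly_Mapping.single a 1) p (Poly_Mapping.single a' 1) = modeB N a p a'"
  by (simp add: mode_eq_linex)

lemma embed_mono: "embed (mono \<mu>) d = Poly_Mapping.single (\<mu>, d) 1"
  by (simp add: embed_eq_linex mono_def)

lemma wproj_mono: "wproj W (mono \<mu>) = (if int (sum_mset \<mu>) = W then mono \<mu> else 0)"
  by (simp add: wproj_eq_linex) (simp add: mono_def)

lemma ann_op_mono: "ann_op N c n (mono \<rho>) =
      cscale (((-1::complex) gchoose (n - 1)) * of_int N * of_int c) (mono \<rho>)
    + (\<Sum>m\<in>{m\<in>set_mset \<rho>. 1 \<le> m}.
         cscale (((- of_nat m - 1 :: complex) gchoose (n - 1)) * of_nat m * of_int N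
                  * of_nat (count \<rho> m)) (mono (\<rho> - {#m#})))"
  unfolding ann_op_def lin_ext_eq_linex mono_def[of \<rho>] linex_single by (simp add: mono_def)

lemma shift_op_mono:
  "shift_op N b (mono \<rho>) = (\<Prod>m\<in>#\<rho>. xvar m + cnst (- of_int (N * b)))"
  unfolding shift_op_def lin_ext_eq_linex mono_def linex_single by simp

section \<open>The involution\<close>

text \<open>The Heisenberg part of \<open>theta\<close>: the algebra automorphism of M(1) with x_m
  -> -x_m.\<close>

definition alternate :: "m1 \<Rightarrow> m1" where
  "alternate = linex (\<lambda>\<mu>. cscale ((-1) ^ size \<mu>) (mono \<mu>))"

lemma clin_alternate: "clin alternate"
  unfolding alternate_def by (rule clin_linex)

lemmas alternate_add = clin_add[OF clin_alternate]
  and alternate_cscale = clin_cscale[OF clin_alternate]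
  and alternate_sum = clin_sum[OF clin_alternate]

lemma alternate_mono: "alternate (mono \<mu>) = cscale ((-1) ^ size \<mu>) (mono \<mu>)"
  unfolding alternate_def mono_def linex_single by simp

lemma alternate_mult: "alternate (f * g) = alternate f * alternate g"
proof (rule clin_eq_on[where g = "\<lambda>f. alternate (f * g)" and h = "\<lambda>f. alternate f * alternate g"])
  fix \<mu>
  show "alternate (Poly_Mapping.single \<mu> 1 * g) = alternate (Poly_Mapping.single \<mu> 1) * alternate g"
  proof (rule clin_eq_on[where f = g])
    fix \<nu>
    show "alternate (Poly_Mapping.single \<mu> 1 * Poly_Mapping.single \<nu> 1) =
      alternate (Poly_Mapping.single \<mu> 1) * alternate (Poly_Mapping.single \<nu> 1)"
      unfolding mono_def[symmetric] mono_plus[symmetric] alternate_mono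
      by (simp add: mono_plus cscale_m1 power_add cnst_mult mult_ac)
  qed (intro clin_comp[OF clin_alternate] clin_comp[OF clin_mult_right] clin_alternate clin_mult_right)+
qed (intro clin_comp[OF clin_alternate] clin_comp[OF clin_mult_left] clin_alternate clin_mult_left)+

lemma alternate_cnst [simp]: "alternate (cnst c) = cnst c"
  unfolding cnst_def single_eq_mono alternate_cscale alternate_mono by simp

lemma alternate_1 [simp]: "alternate 1 = 1"
  using alternate_cnst[of 1] by (simp del: alternate_cnst)

lemma alternate_xvar [simp]: "alternate (xvar m) = - xvar m"
  unfolding xvar_def alternate_mono by (simp add: cscale_minus_one)

lemma alternate_power: "alternate (f ^ n) = alternate f ^ n"
  by (induction n) (simp_all add: alternate_mult)

lemma alternate_prod: "alternate (prod f A) = (\<Prod>x\<in>A. alternate (f x))"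
  by (induction A rule: infinite_finite_induct) (simp_all add: alternate_mult)

lemma alternate_prod_mset: "alternate (\<Prod>m\<in>#\<rho>. f m) = (\<Prod>m\<in>#\<rho>. alternate (f m))"
  by (induction \<rho>) (simp_all add: alternate_mult)

lemma theta_embed: "theta (embed P d) = embed (alternate P) (- d)"
proof (rule clin_eq_on[where f = P])
  show "clin (\<lambda>P. theta (embed P d))" "clin (\<lambda>P. embed (alternate P) (- d))"
    by (intro clin_comp[OF clin_theta] clin_comp[OF clin_embed] clin_embed clin_alternate)+
  show "theta (embed (Poly_Mapping.single \<mu> 1) d) = embed (alternate (Poly_Mapping.single \<mu> 1)) (- d)" for \<mu>
    unfolding mono_def[symmetric] alternate_mono clin_cscale[OF clin_embed] embed_mono
    by (simp add: theta_eq_linex)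
qed

lemma alternate_wproj: "alternate (wproj W f) = wproj W (alternate f)"
proof (rule clin_eq_on[where f = f])
  show "clin (\<lambda>f. alternate (wproj W f))" "clin (\<lambda>f. wproj W (alternate f))"
    by (intro clin_comp[OF clin_wproj] clin_comp[OF clin_alternate] clin_wproj clin_alternate)+
  show "alternate (wproj W (Poly_Mapping.single \<mu> 1)) = wproj W (alternate (Poly_Mapping.single \<mu> 1))" for \<mu>
    unfolding mono_def[symmetric] alternate_mono clin_cscale[OF clin_wproj] wproj_mono
    by (simp add: alternate_mono clin_0[OF clin_alternate])
qed

lemma alternate_cre_op: "alternate (cre_op n W) = - cre_op n W"
  unfolding cre_op_def alternate_sum alternate_cscale sum_negf[symmetric] by (simp add: cscale_m1)

lemma alternate_exp_op: "alternate (exp_op b W) = exp_op (- b) W"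
  by (simp add: exp_op_def alternate_sum alternate_cscale alternate_power)
     (simp add: cscale_m1 cnst_minus)

lemma alternate_shift_op: "alternate (shift_op N b f) = shift_op N (- b) (alternate f)"
proof (rule clin_eq_on[where f = f])
  show "clin (\<lambda>f. alternate (shift_op N b f))" "clin (\<lambda>f. shift_op N (- b) (alternate f))"
    by (intro clin_comp[OF clin_shift_op] clin_comp[OF clin_alternate] clin_shift_op clin_alternate)+
  have "(\<Prod>m\<in>#\<mu>. - xvar m + cnst (- of_int (N * b)))
      = cscale ((- 1) ^ size \<mu>) (\<Prod>m\<in>#\<mu>. xvar m + cnst (- of_int (N * - b)))" for \<mu>
    by (induction \<mu>) (simp_all add: cscale_m1 cnst_minus cnst_mult algebra_simps)
  then show "alternate (shift_op N b (Poly_Mapping.single \<mu> 1)) = shift_op N (- b) (alternate (Poly_Mapping.single \<mu> 1))" for \<mu>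
    unfolding mono_def[symmetric] alternate_mono clin_cscale[OF clin_shift_op] shift_op_mono
    by (simp add: alternate_prod_mset alternate_add)
qed

text \<open>The zero mode changes sign with \<open>c\<close>, and removing one variable changes the
  parity of the length.\<close>

lemma alternate_ann_op: "alternate (ann_op N c n f) = - ann_op N (- c) n (alternate f)"
proof (rule clin_eq_on[where f = f])
  show "clin (\<lambda>f. alternate (ann_op N c n f))"
    by (intro clin_comp[OF clin_alternate] clin_ann_op)
  have "clin (\<lambda>f. cscale (-1) (ann_op N (- c) n (alternate f)))"
    by (intro clin_cmul clin_comp[OF clin_ann_op] clin_alternate)
  then show "clin (\<lambda>f. - ann_op N (- c) n (alternate f))"
    by (simp add: cscale_minus_one)
  have *: "(- 1 :: complex) ^ size (\<mu> - {#m#}) = - ((- 1) ^ size \<mu>)" if "m \<in># \<mu>" for m and \<mu> :: "nat multiset"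
    using that by (metis insert_DiffM power_Suc size_add_mset mult_minus1 minus_minus)
  show "alternate (ann_op N c n (Poly_Mapping.single \<mu> 1)) = - ann_op N (- c) n (alternate (Poly_Mapping.single \<mu> 1))" for \<mu>
    unfolding mono_def[symmetric] alternate_mono clin_cscale[OF clin_ann_op] ann_op_mono
      alternate_add alternate_sum alternate_cscale
    unfolding cscale_minus_one[symmetric] cscale_add cscale_sum
    by (simp add: * mult_ac)
qed

lemma alternate_foldr_ann_op:
  "alternate (foldr (\<lambda>i. ann_op N c (g i)) is f)
   = cscale ((-1) ^ length is) (foldr (\<lambda>i. ann_op N (- c) (g i)) is (alternate f))"
  by (induction "is")
     (simp_all add: alternate_ann_op clin_cscale[OF clin_ann_op] clin_minus[OF clin_ann_op]
       flip: cscale_minus_one)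

lemma clin_foldr_ann_op: "clin (foldr (\<lambda>i. ann_op N c (g i)) is)"
proof (induction "is")
  case (Cons a "is")
  then show ?case using clin_comp[OF clin_ann_op Cons] by (simp add: comp_def)
qed (simp add: clin_id id_def)

text \<open>In every summand \<open>S\<close> each of the \<open>size \<mu>\<close> fields
  contributes one sign, whether it creates or annihilates, and \<nu> contributes
  \<open>size \<nu>\<close> signs; what remains is the reversal of both charges. The output weight
  depends on the charges through \<open>b * c\<close> alone and is therefore unchanged.\<close>

lemma theta_modeB:
  "theta (modeB N (\<mu>, b) p (\<nu>, c)) = cscale ((-1) ^ (size \<mu> + size \<nu>)) (modeB N (\<mu>, - b) p (\<nu>, - c))"
proof -
  let ?ns = "sorted_list_of_multiset \<mu>"
  let ?r = "length ?ns"
  define Wi where "Wi = int (sum_mset \<nu>) + int (sum_mset \<mu>) - N * b * c - p - 1"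
  let ?W = "nat Wi"
  define G where "G = (\<lambda>b c S. (\<Prod>i\<in>S. cre_op (?ns ! i) ?W) * exp_op b ?W *
               shift_op N b (foldr (\<lambda>i. ann_op N c (?ns ! i)) (filter (\<lambda>i. i \<notin> S) [0..<?r]) (mono \<nu>)))"
  have r: "?r = size \<mu>"
    by (metis mset_sorted_list_of_multiset size_mset)
  have modeB: "modeB N (\<mu>, b') p (\<nu>, c') =
      (if Wi < 0 then 0 else (\<Sum>S\<in>Pow {..<?r}. embed (wproj Wi (G b' c' S)) (b' + c')))"
    if "b' * c' = b * c" for b' c'
  proof -
    have "Wi = int (sum_mset \<nu>) + int (sum_mset \<mu>) - N * b' * c' - p - 1"
      unfolding Wi_def using that by (simp add: mult.assoc)
    then show ?thesis unfolding modeB_def G_def Let_def by simp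
  qed
  have G: "alternate (G b c S) = cscale ((-1) ^ (size \<mu> + size \<nu>)) (G (- b) (- c) S)" if "S \<in> Pow {..<?r}" for S
  proof -
    have "length (filter (\<lambda>i. i \<notin> S) [0..<?r]) = card ({..<?r} - S)"
      by (subst distinct_card[symmetric]) (auto intro: arg_cong[where f = card])
    also have "\<dots> = ?r - card S" using that by (subst card_Diff_subset) (auto intro: finite_subset)
    finally have l: "card S + length (filter (\<lambda>i. i \<notin> S) [0..<?r]) = size \<mu>"
      using that card_mono[of "{..<?r}" S] r by auto
    have "(\<Prod>i\<in>S. - cre_op (?ns ! i) ?W) = cscale ((-1) ^ card S) (\<Prod>i\<in>S. cre_op (?ns ! i) ?W)"
      by (subst prod_uminus) (simp add: cscale_m1 cnst_power cnst_minus)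
    then show ?thesis
      unfolding G_def l[symmetric]
      by (simp add: alternate_mult alternate_prod alternate_cre_op alternate_exp_op alternate_shift_op
          alternate_foldr_ann_op alternate_mono clin_cscale[OF clin_shift_op])
         (simp add: clin_cscale[OF clin_foldr_ann_op] clin_cscale[OF clin_shift_op],
          simp add: cscale_m1 cnst_mult power_add mult_ac)
  qed
  show ?thesis
    by (simp add: modeB clin_0[OF clin_theta] clin_sum[OF clin_theta] theta_embed alternate_wproj G
        clin_cscale[OF clin_wproj] clin_cscale[OF clin_embed] cscale_sum)
qed

lemma theta_mode: "theta (mode N u p v) = mode N (theta u) p (theta v)"
proof (rule clin_eq_on[where f = u])
  show "clin (\<lambda>u. theta (mode N u p v))" "clin (\<lambda>u. mode N (theta u) p (theta v))"
    by (intro clin_comp[OF clin_theta] clin_comp[OF clin_mode_left] clin_mode_left clin_theta)+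
next
  fix a :: "nat multiset \<times> int"
  show "theta (mode N (Poly_Mapping.single a 1) p v) = mode N (theta (Poly_Mapping.single a 1)) p (theta v)"
  proof (rule clin_eq_on[where f = v])
    show "clin (\<lambda>v. theta (mode N (Poly_Mapping.single a 1) p v))"
      "clin (\<lambda>v. mode N (theta (Poly_Mapping.single a 1)) p (theta v))"
      by (intro clin_comp[OF clin_theta] clin_comp[OF clin_mode_right] clin_mode_right clin_theta)+
  next
    fix a' :: "nat multiset \<times> int"
    obtain \<mu> b \<nu> c where [simp]: "a = (\<mu>, b)" "a' = (\<nu>, c)" by (cases a, cases a')
    have "theta (Poly_Mapping.single x 1) = cscale ((-1) ^ size (fst x)) (Poly_Mapping.single (fst x, - snd x) 1)" for x
      by (simp add: theta_eq_linex)
    then show "theta (mode N (Poly_Mapping.single a 1) p (Poly_Mapping.single a' 1)) =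
        mode N (theta (Poly_Mapping.single a 1)) p (theta (Poly_Mapping.single a' 1))"
      by (simp add: mode_single clin_cscale[OF clin_mode_left] clin_cscale[OF clin_mode_right] theta_modeB power_add mult.commute
          del: cscale_single)
  qed
qed

lemma theta_theta: "theta (theta v) = v"
  by (rule clin_eq_on[where g = "\<lambda>v. theta (theta v)"])
     (auto intro: clin_comp[OF clin_theta clin_theta] clin_id, simp add: theta_eq_linex power_add[symmetric])

section \<open>The fixed point subalgebra and its $C_2$-subspace\<close>

definition zero_free :: "nat multiset set" where
  "zero_free = {\<mu>. 0 \<notin># \<mu>}"

lemma zero_free_simps [simp]:
  "{#} \<in> zero_free" "\<mu> + \<nu> \<in> zero_free \<longleftrightarrow> \<mu> \<in> zero_free \<and> \<nu> \<in> zero_free"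
  "add_mset m \<mu> \<in> zero_free \<longleftrightarrow> m > 0 \<and> \<mu> \<in> zero_free"
  by (auto simp: zero_free_def)

lemma zero_free_diff: "\<mu> \<in> zero_free \<Longrightarrow> \<mu> - \<nu> \<in> zero_free"
  by (auto simp: zero_free_def dest: in_diffD)

lemma VL_eq_supp: "VL = supp (zero_free \<times> UNIV)"
  by (auto simp: VL_def supp_def zero_free_def)

lemma supp_mono_poly: "\<mu> \<in> A \<Longrightarrow> mono \<mu> \<in> supp A"
  unfolding mono_def by (rule supp_single)

lemma supp_wproj: "f \<in> supp A \<Longrightarrow> wproj W f \<in> supp (A \<inter> {\<mu>. int (sum_mset \<mu>) = W})"
  unfolding wproj_eq_linex
  by (rule csub_linex[OF csub_supp]) (auto intro: supp_mono_poly csub_0 csub_supp dest: supp_keysD)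

lemma embed_in_VL: "P \<in> supp zero_free \<Longrightarrow> embed P d \<in> VL"
  unfolding embed_eq_linex VL_eq_supp
  by (rule csub_linex[OF csub_supp]) (auto intro: supp_single dest: supp_keysD)

lemma supp_zero_free_mult:
  "f \<in> supp zero_free \<Longrightarrow> g \<in> supp zero_free \<Longrightarrow> f * g \<in> supp zero_free"
  by (rule supp_mult) auto

lemma supp_xvar: "m > 0 \<Longrightarrow> xvar m \<in> supp zero_free"
  unfolding xvar_def by (rule supp_mono_poly) simp

lemma supp_cre_op: "cre_op n W \<in> supp zero_free"
  unfolding cre_op_def by (intro csub_sum csub_cscale csub_supp supp_xvar) auto

lemma supp_power:
  "f \<in> supp zero_free \<Longrightarrow> f ^ n \<in> supp zero_free"
  by (induction n) (auto intro: supp_one supp_zero_free_mult)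

lemma supp_exp_op: "exp_op b W \<in> supp zero_free"
  unfolding exp_op_def by (intro csub_sum csub_cscale csub_supp supp_power supp_xvar) auto

lemma supp_cnst: "cnst c \<in> supp zero_free"
  unfolding cnst_def by (rule supp_single) simp

lemma supp_shift_op:
  assumes "f \<in> supp zero_free"
  shows "shift_op N b f \<in> supp zero_free"
proof -
  have "(\<Prod>m\<in>#\<rho>. xvar m + cnst (- of_int (N * b))) \<in> supp zero_free" if "\<rho> \<in> zero_free" for \<rho>
    using that by (induction \<rho>) (auto intro!: supp_one supp_zero_free_mult csub_add csub_supp supp_xvar supp_cnst)
  then show ?thesis
    unfolding shift_op_def lin_ext_eq_linex using assms
    by (intro csub_linex csub_supp) (auto dest: supp_keysD)
qed

lemma supp_ann_op: "f \<in> supp zero_free \<Longrightarrow> ann_op N c n f \<in> supp zero_free"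
  unfolding ann_op_def lin_ext_eq_linex
  by (intro csub_linex csub_supp)
     (auto intro!: csub_add csub_sum csub_cscale csub_supp supp_mono_poly zero_free_diff dest: supp_keysD)

text \<open>The part of \<open>modeB\<close> inside M(1); as all summands have the same charge
  \<open>b + c\<close>, later computations take place in the polynomial ring.\<close>

definition modeP :: "int \<Rightarrow> nat multiset \<Rightarrow> int \<Rightarrow> int \<Rightarrow> nat multiset \<Rightarrow> int \<Rightarrow> m1" where
  "modeP N \<mu> b p \<nu> c =
     (let ns = sorted_list_of_multiset \<mu>;
          r = length ns;
          Wi = int (sum_mset \<nu>) + int (sum_mset \<mu>) - N * b * c - p - 1;
          W = nat Wi
      in if Wi < 0 then 0 else
        (\<Sum>S\<in>Pow {..<r}.
           wproj Wi
              ((\<Prod>i\<in>S. cre_op (ns ! i) W) * exp_op b W *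
               shift_op N b (foldr (\<lambda>i f. ann_op N c (ns ! i) f)
                                   (filter (\<lambda>i. i \<notin> S) [0..<r]) (mono \<nu>)))))"

lemma modeB_eq_embed: "modeB N (\<mu>, b) p (\<nu>, c) = embed (modeP N \<mu> b p \<nu> c) (b + c)"
  by (simp add: modeB_def modeP_def Let_def clin_0[OF clin_embed] clin_sum[OF clin_embed])

lemma supp_modeP:
  assumes "\<nu> \<in> zero_free"
  shows "modeP N \<mu> b p \<nu> c \<in> supp (zero_free \<inter> {\<rho>. int (sum_mset \<rho>) = int (sum_mset \<nu>) + int (sum_mset \<mu>) - N * b * c - p - 1})"
proof -
  have "foldr (\<lambda>i. ann_op N c (g i)) is (mono \<nu>) \<in> supp zero_free" for "is" :: "nat list" and g
    by (induction "is") (auto intro: supp_ann_op supp_mono_poly assms)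
  then show ?thesis
    unfolding modeP_def Let_def
    by (auto intro!: csub_0 csub_sum csub_supp supp_wproj supp_zero_free_mult supp_exp_op supp_shift_op
        supp_prod supp_cre_op simp del: of_nat_sum_mset)
qed

lemma mode_in_VL:
  assumes "u \<in> VL" "v \<in> VL"
  shows "mode N u p v \<in> VL"
proof -
  have "modeB N a p a' \<in> VL" if "a' \<in> zero_free \<times> UNIV" for a a'
    using that by (cases a, cases a') (auto simp: modeB_eq_embed intro!: embed_in_VL supp_mono[OF _ supp_modeP])
  then show ?thesis
    using assms unfolding mode_eq_linex VL_eq_supp
    by (intro csub_linex csub_supp) (auto dest: supp_keysD)
qed

lemma theta_in_VL: "v \<in> VL \<Longrightarrow> theta v \<in> VL"
  unfolding theta_eq_linex VL_eq_supp
  by (rule csub_linex[OF csub_supp]) (auto intro!: supp_single dest: supp_keysD)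

lemma mode_in_VLplus: "u \<in> VLplus \<Longrightarrow> v \<in> VLplus \<Longrightarrow> mode N u p v \<in> VLplus"
  by (auto simp: VLplus_def mode_in_VL theta_mode)

lemma csub_VLplus: "csub VLplus"
  using csub_supp[of "zero_free \<times> UNIV"]
  by (auto simp: VLplus_def VL_eq_supp csub_def clin_0[OF clin_theta] clin_add[OF clin_theta] clin_cscale[OF clin_theta])

lemma C2_subset: "C2 N VLplus \<subseteq> VLplus"
  by (auto simp: C2_def intro!: csub_sum csub_cscale csub_VLplus mode_in_VLplus)

lemma mode_in_C2: "u \<in> V \<Longrightarrow> w \<in> V \<Longrightarrow> mode N u (- 2) w \<in> C2 N V"
  unfolding C2_def
  by (rule CollectI, rule exI[of _ 1], rule exI[of _ "\<lambda>_. 1"], rule exI[of _ "\<lambda>_. u"], rule exI[of _ "\<lambda>_. w"]) simp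

lemma csub_C2: "csub (C2 N V)"
  unfolding csub_def
proof (intro conjI ballI allI)
  show "0 \<in> C2 N V" unfolding C2_def by (auto intro!: exI[of _ 0])
next
  fix x y assume "x \<in> C2 N V" "y \<in> C2 N V"
  then obtain n :: nat and c u w and m :: nat and d s t where *: "\<forall>i<n. u i \<in> V \<and> w i \<in> V"
    "x = (\<Sum>i<n. cscale (c i) (mode N (u i) (- 2) (w i)))"
    "\<forall>i<m. s i \<in> V \<and> t i \<in> V"
    "y = (\<Sum>i<m. cscale (d i) (mode N (s i) (- 2) (t i)))"
    unfolding C2_def by blast
  show "x + y \<in> C2 N V" unfolding C2_def
  proof (rule CollectI, intro exI conjI)
    let ?f = "\<lambda>g h i. if i < n then g i else h (i - n)"
    show "\<forall>i<n + m. ?f u s i \<in> V \<and> ?f w t i \<in> V" using * by auto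
    have "x + y = (\<Sum>i<n. cscale (?f c d i) (mode N (?f u s i) (- 2) (?f w t i))) +
       (\<Sum>i<m. cscale (?f c d (i + n)) (mode N (?f u s (i + n)) (- 2) (?f w t (i + n))))"
      using * by simp
    also have "\<dots> = (\<Sum>i<n + m. cscale (?f c d i) (mode N (?f u s i) (- 2) (?f w t i)))"
      using sum.atLeastLessThan_concat[of 0 n "n + m" "\<lambda>i. cscale (?f c d i) (mode N (?f u s i) (- 2) (?f w t i))"]
        sum.shift_bounds_nat_ivl[of "\<lambda>i. cscale (?f c d i) (mode N (?f u s i) (- 2) (?f w t i))" 0 n m]
      by (simp add: atLeast0LessThan add.commute)
    finally show "x + y = (\<Sum>i<n + m. cscale (?f c d i) (mode N (?f u s i) (- 2) (?f w t i)))" .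
  qed
next
  fix e x assume "x \<in> C2 N V"
  then obtain n :: nat and c u w where *: "\<forall>i<n. u i \<in> V \<and> w i \<in> V"
    "x = (\<Sum>i<n. cscale (c i) (mode N (u i) (- 2) (w i)))"
    unfolding C2_def by blast
  show "cscale e x \<in> C2 N V" unfolding C2_def
  proof (rule CollectI, intro exI conjI)
    show "\<forall>i<n. u i \<in> V \<and> w i \<in> V" by fact
    show "cscale e x = (\<Sum>i<n. cscale (e * c i) (mode N (u i) (- 2) (w i)))"
      using * by (simp add: cscale_sum)
  qed
qed

text \<open>The map F of the overview. On fixed points it is multiplication by 2.\<close>

definition symm :: "vl \<Rightarrow> vl" where
  "symm v = v + theta v"

lemma clin_symm: "clin symm"
  unfolding symm_def by (intro clin_plus clin_id clin_theta)

lemma symm_theta: "symm (theta v) = symm v"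
  by (simp add: symm_def theta_theta add.commute)

lemma symm_in_VLplus: "v \<in> VL \<Longrightarrow> symm v \<in> VLplus"
  using csub_add[OF csub_supp, of v "zero_free \<times> UNIV" "theta v"]
  by (simp add: VLplus_def symm_def theta_in_VL clin_add[OF clin_theta] theta_theta add.commute flip: VL_eq_supp)

lemma symm_mode_left:
  assumes "u \<in> VL" "v \<in> VLplus"
  shows "symm (mode N u (- 2) v) \<in> C2 N VLplus"
  using mode_in_C2[OF symm_in_VLplus[OF assms(1)] assms(2), of N] assms(2)
  by (simp add: symm_def theta_mode clin_add[OF clin_mode_left] VLplus_def)

lemma symm_mode_right:
  assumes "u \<in> VLplus" "v \<in> VL"
  shows "symm (mode N u (- 2) v) \<in> C2 N VLplus"
  using mode_in_C2[OF assms(1) symm_in_VLplus[OF assms(2)], of N] assms(1)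
  by (simp add: symm_def theta_mode clin_add[OF clin_mode_right] VLplus_def)

text \<open>By \<open>theta_mode\<close> the four products in F(u)_{-2} F(v) form two orbits of
  \<open>theta\<close>, represented by u_{-2} v and (theta u)_{-2} v.\<close>

lemma symm_mode_both:
  assumes "u \<in> VL" "v \<in> VL"
  shows "symm (mode N u (- 2) v) + symm (mode N (theta u) (- 2) v) \<in> C2 N VLplus"
  using symm_mode_right[OF symm_in_VLplus[OF assms(1)] assms(2), of N]
  by (simp add: symm_def[of u] clin_add[OF clin_mode_left] clin_add[OF clin_symm])

text \<open>The condition that F(P e^{M\<alpha>}) lies in C_2, seen as a subspace of M(1) for a
  fixed charge.\<close>

definition KC2 :: "int \<Rightarrow> int \<Rightarrow> m1 set" where
  "KC2 N M = {P. symm (embed P M) \<in> C2 N VLplus}"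

lemma csub_KC2: "csub (KC2 N M)"
  unfolding KC2_def by (intro csub_vimage csub_C2 clin_comp[OF clin_symm] clin_embed)

lemma single_in_VL: "\<mu> \<in> zero_free \<Longrightarrow> Poly_Mapping.single (\<mu>, b) c \<in> VL"
  unfolding VL_eq_supp by (rule supp_single) simp

lemma theta_single:
  "theta (Poly_Mapping.single (\<mu>, b) 1) = cscale ((-1) ^ size \<mu>) (Poly_Mapping.single (\<mu>, - b) 1)"
  by (simp add: theta_eq_linex)

text \<open>The vacuum is fixed by \<open>theta\<close>, so only the left factor is symmetrised and
  a single component, of charge \<open>M\<close>, results.\<close>

lemma modeP_vacuum_in_KC2:
  assumes "\<mu> \<in> zero_free"
  shows "modeP N \<mu> M (- 2) {#} 0 \<in> KC2 N M"
proof -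
  have "Poly_Mapping.single ({#}, 0) 1 \<in> VLplus"
    by (simp add: VLplus_def single_in_VL theta_single)
  from symm_mode_left[OF single_in_VL[OF assms, of M 1] this, of N]
  show ?thesis by (simp add: KC2_def mode_single modeB_eq_embed)
qed

text \<open>A monomial of even length and charge 0 is fixed by \<open>theta\<close> and its modes
  preserve the charge, so no second component appears.\<close>

lemma modeP_even_in_KC2:
  assumes "\<mu> \<in> zero_free" "\<nu> \<in> zero_free" "even (size \<mu>)"
  shows "modeP N \<mu> 0 (- 2) \<nu> M \<in> KC2 N M"
proof -
  have "Poly_Mapping.single (\<mu>, 0) 1 \<in> VLplus"
    using assms by (simp add: VLplus_def single_in_VL theta_single)
  from symm_mode_right[OF this single_in_VL[OF assms(2), of M 1], of N]
  show ?thesis by (simp add: KC2_def mode_single modeB_eq_embed)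
qed

text \<open>The components of charge m+c and c-m add up, with a sign from \<open>theta\<close>, to
  an element of C_2; one lies in C_2 once the other does. This is how the charge is lowered.\<close>

lemma modeP_transfer:
  assumes "\<mu> \<in> zero_free" "\<nu> \<in> zero_free" and "modeP N \<mu> m (- 2) \<nu> c \<in> KC2 N (m + c)"
  shows "modeP N \<mu> (- m) (- 2) \<nu> c \<in> KC2 N (c - m)"
proof -
  let ?s = "(-1 :: complex) ^ size \<mu>"
  have "symm (mode N (Poly_Mapping.single (\<mu>, m) 1) (- 2) (Poly_Mapping.single (\<nu>, c) 1))
    + symm (mode N (theta (Poly_Mapping.single (\<mu>, m) 1)) (- 2) (Poly_Mapping.single (\<nu>, c) 1)) \<in> C2 N VLplus"
    by (intro symm_mode_both single_in_VL assms)
  then have "symm (embed (modeP N \<mu> m (- 2) \<nu> c) (m + c))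
      + cscale ?s (symm (embed (modeP N \<mu> (- m) (- 2) \<nu> c) (c - m))) \<in> C2 N VLplus"
    unfolding theta_single clin_cscale[OF clin_mode_left] clin_cscale[OF clin_symm] mode_single modeB_eq_embed
    by simp
  from csub_diff[OF csub_C2 this, of "symm (embed (modeP N \<mu> m (- 2) \<nu> c) (m + c))"] assms(3)
  have "cscale ?s (symm (embed (modeP N \<mu> (- m) (- 2) \<nu> c) (c - m))) \<in> C2 N VLplus"
    by (simp add: KC2_def)
  then show ?thesis using csub_cscale_cancel[OF csub_C2, of ?s] by (simp add: KC2_def)
qed

text \<open>Every fixed vector is half of its own image under F, and F takes the same values, up to
  sign, on the basis vectors of charges b and -b.\<close>

lemma VLplus_subset_C2:
  assumes "\<And>\<mu> b. \<mu> \<in> zero_free \<Longrightarrow> b \<ge> 0 \<Longrightarrow> mono \<mu> \<in> KC2 N b"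
  shows "VLplus \<subseteq> C2 N VLplus"
proof
  fix v assume v: "v \<in> VLplus"
  have *: "symm (Poly_Mapping.single (\<mu>, b) 1) \<in> C2 N VLplus" if "\<mu> \<in> zero_free" for \<mu> b
  proof (cases "b \<ge> 0")
    case True
    then show ?thesis using assms[OF that True] by (simp add: KC2_def embed_mono)
  next
    case False
    have "symm (theta (Poly_Mapping.single (\<mu>, b) 1)) \<in> C2 N VLplus"
      unfolding theta_single clin_cscale[OF clin_symm]
      using assms[OF that, of "- b"] False by (intro csub_cscale csub_C2) (simp add: KC2_def embed_mono)
    then show ?thesis by (simp add: symm_theta)
  qed
  have "symm v \<in> C2 N VLplus"
  proof (rule csub_clin_image[OF csub_C2 clin_symm])
    fix x assume "x \<in> Poly_Mapping.keys v"
    moreover have "v \<in> supp (zero_free \<times> UNIV)" using v by (simp add: VLplus_def VL_eq_supp)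
    ultimately have "fst x \<in> zero_free" using supp_keysD[of v "zero_free \<times> UNIV" x] by (auto simp: mem_Times_iff)
    then show "symm (Poly_Mapping.single x 1) \<in> C2 N VLplus" using *[of "fst x" "snd x"] by simp
  qed
  moreover have "symm v = cscale 2 v"
    using v cscale_add_left[of 1 1 v] by (simp add: symm_def VLplus_def)
  ultimately show "v \<in> C2 N VLplus"
    using csub_cscale_cancel[OF csub_C2, of 2 v] by simp
qed

section \<open>Relations modulo the $C_2$-subspace\<close>

declare of_nat_sum_mset [simp del]

section \<open>Weight spaces and the weight filtration of M(1)\<close>

definition homog :: "nat \<Rightarrow> m1 set" where
  "homog w = supp {\<mu>. sum_mset \<mu> = w}"

definition high :: "nat \<Rightarrow> m1 set" where
  "high w = supp {\<mu>. sum_mset \<mu> \<ge> w}"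

lemma wproj_homog:
  assumes "f \<in> homog w"
  shows "wproj W f = (if W = int w then f else 0)"
proof (rule clin_eq_on[where g = "wproj W" and h = "\<lambda>f. if W = int w then f else 0"])
  show "clin (\<lambda>f. if W = int w then f else 0)" by (cases "W = int w") (simp_all add: clin_id clin_zero)
  fix \<mu> assume "\<mu> \<in> Poly_Mapping.keys f"
  then have "sum_mset \<mu> = w" using assms by (auto simp: homog_def dest: supp_keysD)
  then show "wproj W (Poly_Mapping.single \<mu> 1) = (if W = int w then Poly_Mapping.single \<mu> 1 else 0)"
    by (auto simp: wproj_mono simp flip: mono_def)
qed (rule clin_wproj)

lemma wproj_high:
  assumes "f \<in> high w" "W < int w"
  shows "wproj W f = 0"
proof (rule clin_eq_on[where g = "wproj W" and h = "\<lambda>f. 0"])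
  fix \<mu> assume "\<mu> \<in> Poly_Mapping.keys f"
  then have "sum_mset \<mu> \<ge> w" using assms by (auto simp: high_def dest: supp_keysD)
  then show "wproj W (Poly_Mapping.single \<mu> 1) = 0"
    using assms(2) by (auto simp: wproj_mono simp flip: mono_def)
qed (rule clin_wproj clin_zero)+

lemma homog_mult: "f \<in> homog w \<Longrightarrow> g \<in> homog v \<Longrightarrow> f * g \<in> homog (w + v)"
  unfolding homog_def by (erule supp_mult) auto

lemma high_mult: "f \<in> high w \<Longrightarrow> g \<in> high v \<Longrightarrow> f * g \<in> high (w + v)"
  unfolding high_def by (erule supp_mult) auto

lemma homog_mono: "mono \<mu> \<in> homog (sum_mset \<mu>)"
  unfolding homog_def by (rule supp_mono_poly) simp

lemma homog_xvar: "xvar m \<in> homog m"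
  using homog_mono[of "{#m#}"] by (simp add: xvar_def)

lemma homog_in_high: "w \<le> v \<Longrightarrow> f \<in> homog v \<Longrightarrow> f \<in> high w"
  unfolding homog_def high_def by (erule supp_mono[rotated]) auto

lemma high_antimono: "w \<le> v \<Longrightarrow> f \<in> high v \<Longrightarrow> f \<in> high w"
  unfolding high_def by (erule supp_mono[rotated]) auto

lemma csub_high: "csub (high w)" and csub_homog: "csub (homog w)"
  by (simp_all add: high_def homog_def csub_supp)

section \<open>Modes of quadratic vectors\<close>

lemma cscale_mult_left: "cscale c f * g = cscale c (f * g :: m1)"
  by (simp add: cscale_m1 mult.assoc)

text \<open>Only the variable that fills the missing weight \<open>V - w\<close> survives the
  projection; creation starts at weight 1, hence the value 0 for w >= V.\<close>

lemma wproj_cre_op: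
  assumes "f \<in> homog w"
  shows "wproj (int V) (cre_op n V * f) =
    (if w < V then cscale (of_nat ((V - w - 1) choose (n - 1))) (xvar (V - w) * f) else 0)"
proof -
  have *: "wproj (int V) (xvar m * f) = (if m = V - w then xvar m * f else 0)" if "m \<in> {1..V}" for m
  proof -
    have "int V = int (m + w) \<longleftrightarrow> m = V - w" using that by auto
    then show ?thesis by (simp only: wproj_homog[OF homog_mult[OF homog_xvar assms]])
  qed
  have "wproj (int V) (cre_op n V * f) =
    (\<Sum>m\<in>{1..V}. if m = V - w then cscale (of_nat ((m - 1) choose (n - 1))) (xvar m * f) else 0)"
    unfolding cre_op_def sum_distrib_right clin_sum[OF clin_wproj] cscale_mult_left
        clin_cscale[OF clin_wproj]
    by (rule sum.cong[OF refl]) (simp add: *)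
  then show ?thesis by auto
qed

text \<open>One field creates and the other annihilates. The first term comes from the zero mode;
  contracting with x_m frees weight m, which the created variable takes up as x_{s+m}.\<close>

lemma wproj_cre_op_ann_op:
  assumes "s > 0" "\<nu> \<in> zero_free" "V = sum_mset \<nu> + s"
  shows "wproj (int V) (cre_op i V * ann_op N c j (mono \<nu>)) =
    cscale (((-1) gchoose (j - 1)) * of_int N * of_int c * of_nat ((s - 1) choose (i - 1))) (xvar s * mono \<nu>)
    + (\<Sum>m\<in>set_mset \<nu>. cscale (((- of_nat m - 1) gchoose (j - 1)) * of_nat m * of_int N
         * of_nat (count \<nu> m) * of_nat ((s + m - 1) choose (i - 1))) (xvar (s + m) * mono (\<nu> - {#m#})))"
proof -
  have "{m \<in> set_mset \<nu>. 1 \<le> m} = set_mset \<nu>"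
    using assms(2) by (auto simp: zero_free_def Suc_le_eq) (metis gr0I)
  moreover have "wproj (int V) (cre_op i V * mono (\<nu> - {#m#})) =
      cscale (of_nat ((s + m - 1) choose (i - 1))) (xvar (s + m) * mono (\<nu> - {#m#}))" if "m \<in># \<nu>" for m
  proof -
    have "sum_mset \<nu> = m + sum_mset (\<nu> - {#m#})"
      using that by (rule sum_mset.remove)
    then have "V - sum_mset (\<nu> - {#m#}) = s + m" "sum_mset (\<nu> - {#m#}) < V"
      using assms(1,3) by linarith+
    then show ?thesis by (simp add: wproj_cre_op[OF homog_mono])
  qed
  moreover have "wproj (int V) (cre_op i V * mono \<nu>) = cscale (of_nat ((s - 1) choose (i - 1))) (xvar s * mono \<nu>)"
    unfolding wproj_cre_op[OF homog_mono] using assms by simp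
  ultimately show ?thesis
    unfolding ann_op_mono distrib_left sum_distrib_left clin_add[OF clin_wproj] clin_sum[OF clin_wproj]
      clin_cscale[OF clin_mult_right] clin_cscale[OF clin_wproj] by simp
qed

text \<open>Both fields create. The output lies only 1 above the least possible weight, which is i +
  j more than that of \<nu>, so exactly one of the two variables is raised by one.\<close>

lemma wproj_cre_op_cre_op:
  assumes "0 < i" "0 < j" "V = sum_mset \<nu> + i + j + 1"
  shows "wproj (int V) (cre_op i V * cre_op j V * mono \<nu>) =
    cscale (of_nat i) (xvar (Suc i) * xvar j * mono \<nu>) + cscale (of_nat j) (xvar i * xvar (Suc j) * mono \<nu>)"
proof -
  define c where "c m = (of_nat (((m - 1) choose (j - 1)) * ((V - (m + sum_mset \<nu>) - 1) choose (i - 1))) :: complex)" for m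
  define T where "T m = (if m + sum_mset \<nu> < V then cscale (c m) (xvar (V - (m + sum_mset \<nu>)) * (xvar m * mono \<nu>)) else 0)" for m
  have "wproj (int V) (cre_op i V * cre_op j V * mono \<nu>) = (\<Sum>m\<in>{1..V}. cscale (of_nat ((m - 1) choose (j - 1)))
      (wproj (int V) (cre_op i V * (xvar m * mono \<nu>))))"
    unfolding cre_op_def[of j]
    by (simp add: sum_distrib_left sum_distrib_right clin_sum[OF clin_wproj] clin_cscale[OF clin_mult_right]
         cscale_mult_left clin_cscale[OF clin_wproj] mult.assoc)
  also have "\<dots> = (\<Sum>m\<in>{1..V}. T m)"
    by (intro sum.cong refl)
       (simp add: wproj_cre_op[OF homog_mult[OF homog_xvar homog_mono]] T_def c_def)
  \<comment> \<open>The coefficient \<open>(m - 1) choose (j - 1)\<close> vanishes for m < j, and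
    for m > j + 1 too little weight is left for the first field.\<close>
  also have "\<dots> = (\<Sum>m\<in>{j, Suc j}. T m)"
  proof (rule sum.mono_neutral_right)
    show "\<forall>m\<in>{1..V} - {j, Suc j}. T m = 0"
    proof
      fix m assume m: "m \<in> {1..V} - {j, Suc j}"
      then consider "m < j" | "m > Suc j" by force
      then show "T m = 0"
      proof cases
        case 1
        then have "c m = 0" using m unfolding c_def of_nat_eq_0_iff mult_eq_0_iff binomial_eq_0_iff by auto
        then show ?thesis by (simp add: T_def)
      next
        case 2
        show ?thesis
        proof (cases "m + sum_mset \<nu> < V")
          case True
          then have "V - (m + sum_mset \<nu>) - 1 < i - 1" using 2 assms by arith
          then have "c m = 0" unfolding c_def of_nat_eq_0_iff mult_eq_0_iff binomial_eq_0_iff by auto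
          then show ?thesis by (simp add: T_def)
        qed (simp add: T_def)
      qed
    qed
  qed (use assms in auto)
  also have "\<dots> = T j + T (Suc j)" by simp
  also have "T j = cscale (of_nat i) (xvar (Suc i) * xvar j * mono \<nu>)"
  proof -
    have "V - (j + sum_mset \<nu>) = Suc i" "j + sum_mset \<nu> < V" using assms by auto
    moreover have "i choose (i - 1) = i" using assms(1) by (cases i) (auto simp: binomial_symmetric[of "Suc 0"])
    ultimately show ?thesis by (simp add: T_def c_def mult.assoc)
  qed
  also have "T (Suc j) = cscale (of_nat j) (xvar i * xvar (Suc j) * mono \<nu>)"
  proof -
    have "V - (Suc j + sum_mset \<nu>) = i" "Suc j + sum_mset \<nu> < V" using assms by auto
    moreover have "j choose (j - 1) = j" using assms(2) by (cases j) auto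
    ultimately show ?thesis by (simp add: T_def c_def mult.assoc)
  qed
  finally show ?thesis .
qed

lemma exp_op_0: "exp_op 0 W = 1"
proof -
  have "exp_op 0 W = (\<Sum>j\<in>{0..W}. if j = 0 then 1 else 0)"
    unfolding exp_op_def by (intro sum.cong refl) (simp add: power_0_left cscale_m1)
  then show ?thesis by simp
qed

lemma shift_op_0: "shift_op N 0 f = f"
proof (rule clin_eq_on[where g = "shift_op N 0" and h = "\<lambda>f. f"])
  fix \<mu>
  have "(\<Prod>m\<in>#\<mu>. xvar m) = mono \<mu>" by (induction \<mu>) (simp_all add: mono_add_mset)
  then show "shift_op N 0 (Poly_Mapping.single \<mu> 1) = Poly_Mapping.single \<mu> 1"
    by (simp add: shift_op_mono flip: mono_def)
qed (rule clin_shift_op clin_id)+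

text \<open>Annihilation and zero modes never raise the weight.\<close>

lemma wproj_ann_op_ann_op:
  assumes "W > int (sum_mset \<nu>)"
  shows "wproj W (ann_op N c i (ann_op N c j (mono \<nu>))) = 0"
proof -
  let ?A = "{\<mu>. int (sum_mset \<mu>) < W}"
  have ann: "ann_op N c n f \<in> supp ?A" if "f \<in> supp ?A" for f n
  proof (rule csub_clin_image[OF csub_supp clin_ann_op])
    fix \<mu> assume "\<mu> \<in> Poly_Mapping.keys f"
    then have \<mu>: "\<mu> \<in> ?A" using that by (rule supp_keysD[rotated])
    moreover have "\<mu> - {#m#} \<in> ?A" if "m \<in># \<mu>" for m
    proof -
      have "sum_mset \<mu> = m + sum_mset (\<mu> - {#m#})" using that by (rule sum_mset.remove)
      then have "sum_mset (\<mu> - {#m#}) \<le> sum_mset \<mu>" by linarith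
      then show ?thesis using \<mu> by (simp del: sum_mset_diff)
    qed
    ultimately show "ann_op N c n (Poly_Mapping.single \<mu> 1) \<in> supp ?A"
      unfolding mono_def[symmetric] ann_op_mono
      by (intro csub_add csub_supp csub_sum csub_cscale supp_mono_poly) auto
  qed
  have "ann_op N c i (ann_op N c j (mono \<nu>)) \<in> supp ?A"
    by (intro ann supp_mono_poly) (use assms in simp)
  from supp_wproj[OF this, of W] have "wproj W (ann_op N c i (ann_op N c j (mono \<nu>))) \<in> supp {}"
    by (rule supp_mono[rotated]) auto
  then show ?thesis by (simp add: supp_def)
qed

text \<open>The two ways in which one field contracts with x_m while the other creates x_{i+j+m+1};
  at m = 0 the contraction is the zero mode.\<close>

definition quad_coeff :: "nat \<Rightarrow> nat \<Rightarrow> nat \<Rightarrow> complex" where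
  "quad_coeff i j m =
     ((- of_nat m - 1) gchoose (j - 1)) * of_nat ((i + j + m) choose (i - 1)) +
     ((- of_nat m - 1) gchoose (i - 1)) * of_nat ((i + j + m) choose (j - 1))"

text \<open>This is (x_i x_j)_{-2} on \<nu> e^{M\<alpha>}, split by which of the two fields create.
  The order \<open>i \<le> j\<close> makes the sorted list of the multiset equal to [i, j].\<close>

lemma quadratic_relation:
  assumes "0 < i" "i \<le> j" "\<nu> \<in> zero_free"
  shows "cscale (of_nat i) (xvar (Suc i) * xvar j * mono \<nu>) + cscale (of_nat j) (xvar i * xvar (Suc j) * mono \<nu>)
    + cscale (of_int N * of_int M * quad_coeff i j 0) (xvar (Suc (i + j)) * mono \<nu>)
    + (\<Sum>m\<in>set_mset \<nu>. cscale (of_int N * of_nat m * of_nat (count \<nu> m) * quad_coeff i j m)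
         (xvar (Suc (i + j + m)) * mono (\<nu> - {#m#}))) \<in> KC2 N M"
proof -
  define V where "V = sum_mset \<nu> + i + j + 1"
  have V: "int (sum_mset \<nu>) + int (sum_mset {#i, j#}) - N * 0 * M - (- 2) - 1 = int V" by (simp add: V_def)
  have ns: "sorted_list_of_multiset {#i, j#} = [i, j]"
    using assms(2) sorted_list_of_multiset_mset[of "[i, j]"] by simp
  have P: "Pow {..<2::nat} = {{}, {0}, {1}, {0, 1}}"
    by (auto simp: lessThan_Suc numeral_2_eq_2 Pow_insert)
  have "modeP N {#i, j#} 0 (- 2) \<nu> M =
    wproj (int V) (cre_op i V * cre_op j V * mono \<nu>)
    + wproj (int V) (cre_op i V * ann_op N M j (mono \<nu>))
    + wproj (int V) (cre_op j V * ann_op N M i (mono \<nu>))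
    + wproj (int V) (ann_op N M i (ann_op N M j (mono \<nu>)))"
  proof -
    have f: "filter (\<lambda>i. i \<notin> S) [0..<2::nat] = (if 0 \<in> S then [] else [0]) @ (if 1 \<in> S then [] else [1])" for S
      by (simp add: numeral_2_eq_2)
    have "modeP N {#i, j#} 0 (- 2) \<nu> M = (\<Sum>S\<in>Pow {..<2}. wproj (int V)
       ((\<Prod>l\<in>S. cre_op ([i, j] ! l) V) * (foldr (\<lambda>l f. ann_op N M ([i, j] ! l) f)
                                   (filter (\<lambda>l. l \<notin> S) [0..<2]) (mono \<nu>))))"
      unfolding modeP_def Let_def ns V by (simp add: exp_op_0 shift_op_0 numeral_2_eq_2)
    also have "\<dots> = wproj (int V) (ann_op N M i (ann_op N M j (mono \<nu>)))
      + (wproj (int V) (cre_op i V * ann_op N M j (mono \<nu>))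
      + (wproj (int V) (cre_op j V * ann_op N M i (mono \<nu>))
      + wproj (int V) (cre_op i V * cre_op j V * mono \<nu>)))"
      unfolding P f by simp
    finally show ?thesis by (simp add: add_ac)
  qed
  also have "wproj (int V) (ann_op N M i (ann_op N M j (mono \<nu>))) = 0"
    by (rule wproj_ann_op_ann_op) (simp add: V_def)
  also have "wproj (int V) (cre_op i V * cre_op j V * mono \<nu>) =
    cscale (of_nat i) (xvar (Suc i) * xvar j * mono \<nu>) + cscale (of_nat j) (xvar i * xvar (Suc j) * mono \<nu>)"
    by (rule wproj_cre_op_cre_op) (use assms in \<open>auto simp: V_def\<close>)
  also note wproj_cre_op_ann_op[where s = "Suc (i + j)", OF _ assms(3)]
  also note wproj_cre_op_ann_op[where s = "Suc (i + j)", OF _ assms(3)]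
  finally have "modeP N {#i, j#} 0 (- 2) \<nu> M =
    cscale (of_nat i) (xvar (Suc i) * xvar j * mono \<nu>) + cscale (of_nat j) (xvar i * xvar (Suc j) * mono \<nu>)
    + cscale (of_int N * of_int M * quad_coeff i j 0) (xvar (Suc (i + j)) * mono \<nu>)
    + (\<Sum>m\<in>set_mset \<nu>. cscale (of_int N * of_nat m * of_nat (count \<nu> m) * quad_coeff i j m)
         (xvar (Suc (i + j + m)) * mono (\<nu> - {#m#})))"
    by (simp add: V_def quad_coeff_def algebra_simps cscale_add_left sum.distrib)
  moreover have "modeP N {#i, j#} 0 (- 2) \<nu> M \<in> KC2 N M"
    by (rule modeP_even_in_KC2) (use assms in auto)
  ultimately show ?thesis by simp
qed

section \<open>Translation on M(1), the derivation x_m -> m x_{m+1}\<close>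

definition transl :: "nat multiset \<Rightarrow> m1" where
  "transl \<mu> = (\<Sum>m\<in>#\<mu>. of_nat m * xvar (Suc m) * mono (\<mu> - {#m#}))"

lemma transl_add_mset: "transl (add_mset n \<mu>) = of_nat n * xvar (Suc n) * mono \<mu> + xvar n * transl \<mu>"
proof -
  have "(\<Sum>m\<in>#\<mu>. of_nat m * xvar (Suc m) * mono (add_mset n \<mu> - {#m#})) =
      (\<Sum>m\<in>#\<mu>. xvar n * (of_nat m * xvar (Suc m) * mono (\<mu> - {#m#})))"
    by (intro arg_cong[where f = sum_mset] image_mset_cong) (simp add: mono_add_mset mult_ac)
  then show ?thesis by (simp add: transl_def sum_mset_distrib_left)
qed

lemma homog_transl: "transl \<mu> \<in> homog (Suc (sum_mset \<mu>))"
proof (induction \<mu>)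
  case empty
  then show ?case by (simp add: transl_def csub_0[OF csub_homog])
next
  case (add n \<mu>)
  have "cscale (of_nat n) (xvar (Suc n) * mono \<mu>) \<in> homog (Suc n + sum_mset \<mu>)"
    by (intro csub_cscale csub_homog homog_mult homog_xvar homog_mono)
  moreover have "xvar n * transl \<mu> \<in> homog (n + Suc (sum_mset \<mu>))"
    by (intro homog_mult homog_xvar add)
  ultimately show ?case
    by (auto simp: transl_add_mset cscale_m1 cnst_of_nat mult.assoc intro!: csub_add csub_homog)
qed

text \<open>The coefficient after that of x_n is binom(n, n-1) = n, as in the translate of x_n; n <
  W keeps x_{n+1} inside the truncation.\<close>

lemma cre_op_jet:
  assumes "0 < n" "n < W"
  shows "cre_op n W - xvar n - of_nat n * xvar (Suc n) \<in> high (n + 2)"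
proof -
  let ?t = "\<lambda>m. cscale (of_nat ((m - 1) choose (n - 1))) (xvar m)"
  have "cre_op n W = (\<Sum>m\<in>{n, Suc n}. ?t m) + (\<Sum>m\<in>{1..W} - {n, Suc n}. ?t m)"
    unfolding cre_op_def by (subst sum.subset_diff[of "{n, Suc n}"]) (use assms in auto)
  moreover have "n choose (n - 1) = n" using assms(1) by (cases n) auto
  then have "(\<Sum>m\<in>{n, Suc n}. ?t m) = xvar n + of_nat n * xvar (Suc n)"
    by (simp add: cscale_m1 cnst_of_nat)
  moreover have "(\<Sum>m\<in>{1..W} - {n, Suc n}. ?t m) \<in> high (n + 2)"
  proof (rule csub_sum[OF csub_high])
    fix m assume m: "m \<in> {1..W} - {n, Suc n}"
    show "?t m \<in> high (n + 2)"
    proof (cases "m < n")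
      case True
      then have *: "(of_nat ((m - 1) choose (n - 1)) :: complex) = 0"
        using m unfolding of_nat_eq_0_iff binomial_eq_0_iff by auto
      show ?thesis unfolding * by (simp add: csub_0[OF csub_high])
    next
      case False
      then show ?thesis using m by (intro csub_cscale csub_high homog_in_high[OF _ homog_xvar]) auto
    qed
  qed
  ultimately show ?thesis by simp
qed

text \<open>The product rule for two-term expansions. It rests on f g - f0 g0 - f1 g0 - f0 g1 = (f -
  f0)(g - g0) + (f - f0 - f1) g0 + f0 (g - g0 - g1), where every summand has weight at least w + v +
  2.\<close>

lemma high_jet_mult:
  assumes "f - f0 - f1 \<in> high (w + 2)" "f0 \<in> homog w" "f1 \<in> homog (Suc w)"
    and "g - g0 - g1 \<in> high (v + 2)" "g0 \<in> homog v" "g1 \<in> homog (Suc v)"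
  shows "f * g - f0 * g0 - (f1 * g0 + f0 * g1) \<in> high (w + v + 2)"
proof -
  have f0: "f0 \<in> high w" and f1: "f1 \<in> high (Suc w)" and g0: "g0 \<in> high v" and g1: "g1 \<in> high (Suc v)"
    using assms by (auto intro: homog_in_high)
  have "f1 + (f - f0 - f1) \<in> high (Suc w)"
    by (intro csub_add csub_high f1 high_antimono[OF _ assms(1)]) simp
  moreover have "g1 + (g - g0 - g1) \<in> high (Suc v)"
    by (intro csub_add csub_high g1 high_antimono[OF _ assms(4)]) simp
  ultimately have "(f1 + (f - f0 - f1)) * (g1 + (g - g0 - g1)) \<in> high (w + v + 2)"
    by (intro high_antimono[OF _ high_mult[of _ "Suc w" _ "Suc v"]]) auto
  moreover have "(f - f0 - f1) * g0 \<in> high (w + v + 2)" "f0 * (g - g0 - g1) \<in> high (w + v + 2)"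
    using high_mult[OF assms(1) g0] high_mult[OF f0 assms(4)] by (simp_all add: add_ac)
  ultimately have "(f1 + (f - f0 - f1)) * (g1 + (g - g0 - g1)) + ((f - f0 - f1) * g0 + f0 * (g - g0 - g1))
    \<in> high (w + v + 2)"
    by (intro csub_add csub_high)
  then show ?thesis by (simp add: algebra_simps)
qed

lemma cre_op_prod_jet:
  assumes "\<mu> \<in> zero_free" "\<And>n. n \<in># \<mu> \<Longrightarrow> n < W"
  shows "(\<Prod>n\<in>#\<mu>. cre_op n W) - mono \<mu> - transl \<mu> \<in> high (sum_mset \<mu> + 2)"
  using assms
proof (induction \<mu>)
  case empty
  then show ?case by (simp add: transl_def csub_0[OF csub_high])
next
  case (add n \<mu>)
  have "of_nat n * xvar (Suc n) \<in> homog (Suc n)"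
    using csub_cscale[OF csub_homog homog_xvar, of "of_nat n" "Suc n"] by (simp add: cscale_m1 cnst_of_nat)
  from high_jet_mult[OF cre_op_jet homog_xvar this _ homog_mono homog_transl, of W "\<Prod>n\<in>#\<mu>. cre_op n W" \<mu>] add
  show ?case by (simp add: transl_add_mset mono_add_mset add_ac)
qed

lemma exp_op_jet:
  assumes "W > 0"
  shows "exp_op b W - 1 - cscale (of_int b) (xvar 1) \<in> high 2"
proof -
  define e where "e = (\<Sum>m\<in>{1..W}. cscale (of_int b / of_nat m) (xvar m))"
  have e1: "e - cscale (of_int b) (xvar 1) \<in> high 2"
  proof -
    have "e = (\<Sum>m\<in>{1}. cscale (of_int b / of_nat m) (xvar m))
        + (\<Sum>m\<in>{1..W} - {1}. cscale (of_int b / of_nat m) (xvar m))"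
      unfolding e_def by (subst sum.subset_diff[of "{1}"]) (use assms in auto)
    moreover have "(\<Sum>m\<in>{1..W} - {1}. cscale (of_int b / of_nat m) (xvar m)) \<in> high 2"
      by (intro csub_sum csub_cscale csub_high homog_in_high[OF _ homog_xvar]) auto
    ultimately show ?thesis by simp
  qed
  have e: "e \<in> high 1" unfolding e_def
    by (intro csub_sum csub_cscale csub_high homog_in_high[OF _ homog_xvar]) auto
  have pw: "e ^ j \<in> high j" for j
  proof (induction j)
    case 0
    then show ?case by (simp add: high_def supp_one)
  next
    case (Suc j)
    then show ?case using high_mult[OF e Suc] by simp
  qed
  have "exp_op b W = (\<Sum>j\<in>{0, 1}. cscale (1 / of_nat (fact j)) (e ^ j)) + (\<Sum>j\<in>{0..W} - {0, 1}. cscale (1 / of_nat (fact j)) (e ^ j))"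
    unfolding exp_op_def e_def[symmetric] by (subst sum.subset_diff[of "{0, 1}"]) (use assms in auto)
  moreover have "(\<Sum>j\<in>{0..W} - {0, 1}. cscale (1 / of_nat (fact j)) (e ^ j)) \<in> high 2"
    by (intro csub_sum csub_cscale csub_high high_antimono[OF _ pw]) auto
  ultimately have "exp_op b W - 1 - e \<in> high 2" by simp
  from csub_add[OF csub_high this e1] show ?thesis by (simp add: algebra_simps)
qed

lemma foldr_ann_op_vacuum:
  "is \<noteq> [] \<Longrightarrow> foldr (\<lambda>i. ann_op N 0 (g i)) is (mono {#}) = 0"
proof (induction "is")
  case (Cons a "is")
  then show ?case using ann_op_mono[of N 0 "g a" "{#}"] by (cases "is") (auto simp: clin_0[OF clin_ann_op])
qed simp

text \<open>The product of u with the vacuum is the translate L(-1)u, which acts on the monomial by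
  \<open>transl\<close> and on e^{M\<alpha>} as multiplication by M x_1.\<close>

lemma translation_relation:
  assumes "\<mu> \<in> zero_free"
  shows "transl \<mu> + cscale (of_int M) (xvar 1 * mono \<mu>) \<in> KC2 N M"
proof -
  let ?ns = "sorted_list_of_multiset \<mu>"
  define V where "V = Suc (sum_mset \<mu>)"
  let ?G = "\<lambda>S. wproj (int V) ((\<Prod>i\<in>S. cre_op (?ns ! i) V) * exp_op M V *
               shift_op N M (foldr (\<lambda>i. ann_op N 0 (?ns ! i)) (filter (\<lambda>i. i \<notin> S) [0..<length ?ns]) (mono {#})))"
  have V: "int (sum_mset {#}) + int (sum_mset \<mu>) - N * M * 0 - (- 2) - 1 = int V" by (simp add: V_def)
  have "modeP N \<mu> M (- 2) {#} 0 = (\<Sum>S\<in>Pow {..<length ?ns}. ?G S)"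
    unfolding modeP_def Let_def V by simp
  \<comment> \<open>A single annihilating field kills the vacuum, so only the summand in which all
    fields create is left.\<close>
  also have "\<dots> = (\<Sum>S\<in>{{..<length ?ns}}. ?G S)"
  proof (rule sum.mono_neutral_right)
    show "\<forall>S\<in>Pow {..<length ?ns} - {{..<length ?ns}}. ?G S = 0"
    proof
      fix S assume S: "S \<in> Pow {..<length ?ns} - {{..<length ?ns}}"
      then obtain i where "i < length ?ns" "i \<notin> S" by auto
      then have "filter (\<lambda>i. i \<notin> S) [0..<length ?ns] \<noteq> []" by (auto simp: filter_empty_conv)
      from foldr_ann_op_vacuum[OF this] show "?G S = 0"
        by (simp add: clin_0[OF clin_shift_op] clin_0[OF clin_wproj])
    qed
  qed auto
  also have "\<dots> = wproj (int V) ((\<Prod>i<length ?ns. cre_op (?ns ! i) V) * exp_op M V)"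
  proof -
    have "filter (\<lambda>i. i \<notin> {..<length ?ns}) [0..<length ?ns] = []" by (simp add: filter_empty_conv)
    moreover have "shift_op N M 1 = 1" using shift_op_mono[of N M "{#}"] by simp
    ultimately show ?thesis by simp
  qed
  also have "(\<Prod>i<length ?ns. cre_op (?ns ! i) V) = prod_list (map (\<lambda>n. cre_op n V) ?ns)"
    by (simp add: prod.list_conv_set_nth atLeast0LessThan)
  also have "\<dots> = (\<Prod>n\<in>#\<mu>. cre_op n V)"
    by (metis mset_map mset_sorted_list_of_multiset prod_mset_prod_list)
  \<comment> \<open>\<open>V\<close> is one more than the weight of \<mu>, so the projection reads
    off the second term of the expansion.\<close>
  also have "wproj (int V) ((\<Prod>n\<in>#\<mu>. cre_op n V) * exp_op M V) = transl \<mu> + cscale (of_int M) (xvar 1 * mono \<mu>)"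
  proof -
    let ?f = "(\<Prod>n\<in>#\<mu>. cre_op n V) * exp_op M V" and ?r = "transl \<mu> * 1 + mono \<mu> * cscale (of_int M) (xvar 1)"
    have n: "n < V" if "n \<in># \<mu>" for n
      using sum_mset.remove[OF that] unfolding V_def by linarith
    have x: "cscale (of_int M) (xvar 1) \<in> homog (Suc 0)"
      using homog_xvar[of 1] by (intro csub_cscale csub_homog) simp
    have "?f - mono \<mu> * 1 - ?r \<in> high (sum_mset \<mu> + 0 + 2)"
      by (rule high_jet_mult[OF cre_op_prod_jet[OF assms n] homog_mono homog_transl _ _ x])
         (use exp_op_jet[of V M] homog_mono[of "{#}"] in \<open>auto simp: V_def numeral_2_eq_2\<close>)
    then have "wproj (int V) (?f - mono \<mu> * 1 - ?r) = 0" by (rule wproj_high) (simp add: V_def)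
    moreover have "wproj (int V) (mono \<mu>) = 0" by (simp add: wproj_mono V_def)
    moreover have "?r \<in> homog V"
      using homog_transl[of \<mu>] homog_mult[OF homog_mono x, of \<mu>]
      by (auto simp: V_def intro!: csub_add csub_homog)
    then have "wproj (int V) ?r = ?r" by (simp add: wproj_homog)
    ultimately have "wproj (int V) ((?f - mono \<mu> * 1 - ?r) + mono \<mu> + ?r) = ?r"
      by (simp only: clin_add[OF clin_wproj] add_0_left)
    moreover have "(?f - mono \<mu> * 1 - ?r) + mono \<mu> + ?r = ?f" by simp
    ultimately have "wproj (int V) ?f = ?r" by (simp only:)
    then show ?thesis by (simp add: cscale_m1 mult_ac)
  qed
  finally show ?thesis using modeP_vacuum_in_KC2[OF assms, of N M] by simp
qed

section \<open>Elimination among monomials of length at most three\<close>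

lemma minus_one_gchoose: "(- 1 :: complex) gchoose n = (- 1) ^ n"
  using gbinomial_minus[of "1 :: complex" n] by (simp add: binomial_gbinomial[symmetric])

lemma choose_two_shift: "2 * ((v + 2) choose 2) = (v + 1) * (v + 2)"
  by (induction v) (auto simp: numeral_eq_Suc)

lemma choose_three_shift: "6 * ((v + 2) choose 3) = v * (v + 1) * (v + 2)"
proof (induction v)
  case (Suc v)
  have "(Suc v + 2) choose 3 = ((v + 2) choose 2) + ((v + 2) choose 3)"
    by (simp add: numeral_3_eq_3 numeral_2_eq_2)
  then show ?case using Suc choose_two_shift[of v] by (simp add: algebra_simps)
qed simp

text \<open>Eliminating the length two and three monomials between the relations for
  $\alpha(-w+1)$, $\alpha(-2)\alpha(-w+3)$ and the quadratic relations leaves a multiple of $\alpha(-w)$;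
  its coefficient is nonzero because $k$ below is a sum of two negative terms, the second one since $N < 0$.\<close>

lemma xvar_in_KC2:
  assumes "N < 0" "M > 0" "w \<ge> 5"
  shows "xvar w \<in> KC2 N M"
proof -
  define v where "v = w - 3"
  have v: "w = v + 3" "v \<ge> 2" using assms(3) by (auto simp: v_def)
  define X where "X = xvar w"
  define y1 where "y1 = xvar 1 * xvar (v + 2)"
  define y2 where "y2 = xvar 2 * xvar (v + 1)"
  define y3 where "y3 = xvar 3 * xvar v"
  define t where "t = xvar 1 * xvar 2 * xvar v"
  define A1 where "A1 = quad_coeff 1 (v + 1) 0"
  define A2 where "A2 = quad_coeff 2 v 0"
  define n where "n = (of_int N :: complex)"
  define m where "m = (of_int M :: complex)"
  note defs = X_def y1_def y2_def y3_def t_def v n_def m_def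
  \<comment> \<open>Five relations between X, y1, y2, y3 and t, all of weight w: two from
    translation (E1, E5) and three from quadratic vectors (E2, E3, E4).\<close>
  have E1: "cscale (of_nat (v + 2)) X + cscale m y1 \<in> KC2 N M" (is "?E1 \<in> _")
    using translation_relation[of "{#v + 2#}" M N]
    by (simp add: defs transl_def xvar_def[symmetric] cscale_m1 cnst_of_nat cnst_add cnst_numeral numeral_3_eq_3 add_ac)
  have E2: "y2 + cscale (of_nat (v + 1)) y1 + cscale (n * m * A1) X \<in> KC2 N M" (is "?E2 \<in> _")
    using quadratic_relation[of 1 "v + 1" "{#}" N M]
    by (simp add: defs A1_def numeral_2_eq_2 numeral_3_eq_3 add_ac)
  have E3: "cscale 2 y3 + cscale (of_nat v) y2 + cscale (n * m * A2) X \<in> KC2 N M" (is "?E3 \<in> _")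
    using quadratic_relation[of 2 v "{#}" N M] v(2)
    by (simp add: defs A2_def numeral_2_eq_2 numeral_3_eq_3 add_ac)
  have E4: "cscale 2 t + cscale (2 * n * m) y3 + cscale (2 * n * of_nat v) X \<in> KC2 N M" (is "?E4 \<in> _")
  proof -
    have "quad_coeff 1 1 l = 2" for l by (simp add: quad_coeff_def)
    then show ?thesis
      using quadratic_relation[of 1 1 "{#v#}" N M] v(2)
      by (simp add: defs numeral_2_eq_2 numeral_3_eq_3 add_ac xvar_def[symmetric] mult_ac
          cscale_m1 cnst_add cnst_mult cnst_numeral distrib_right)
  qed
  have E5: "cscale 2 y3 + cscale (of_nat v) y2 + cscale m t \<in> KC2 N M" (is "?E5 \<in> _")
    using translation_relation[of "{#2, v#}" M N] v(2)
    by (simp add: defs transl_def xvar_def[symmetric] mono_add_mset cscale_m1 cnst_of_nat cnst_numeral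
        numeral_2_eq_2 numeral_3_eq_3 add_ac mult_ac)
  \<comment> \<open>What is left at X, divided by n m, once the multipliers below have cancelled t,
    y3, y2 and y1.\<close>
  define \<kappa> where "\<kappa> = 2 * A2 + 2 * of_nat v - of_nat v * (of_nat v + 1) * (of_nat v + 2)
      + n * m * m * (of_nat v * A1 - A2)"
  have "cscale (n * m * \<kappa>) X = cscale m ?E4 + cscale (- 2) ?E5 + cscale (2 - n * m * m) ?E3
     + cscale (of_nat v * n * m * m) ?E2 + cscale (- (of_nat v * n * m * (of_nat v + 1))) ?E1"
    by (rule poly_mapping_eqI) (simp add: lookup_add \<kappa>_def algebra_simps)
  also have "\<dots> \<in> KC2 N M"
    by (intro csub_add csub_cscale csub_KC2 E1 E2 E3 E4 E5)
  finally have *: "cscale (n * m * \<kappa>) X \<in> KC2 N M" .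
  \<comment> \<open>With e = (-1)^v the first part of \<kappa> is -8C + 2v - 2e(v+2) and the second
    is N M^2 (v B + C + 2e(v+1)). Both are negative for v >= 2. At v = 1 both expressions are 0,
    which is why the weight bound is 5.\<close>
  have "\<kappa> \<noteq> 0"
  proof -
    define B where "B = int ((v + 2) choose 2)"
    define C where "C = int ((v + 2) choose 3)"
    obtain e :: int where e: "(- 1) ^ v = (of_int e :: complex)" "e = 1 \<or> e = - 1"
      by (cases "even v") (auto intro: that[of 1] that[of "- 1"])
    have A1: "A1 = of_int (e + B)"
    proof -
      have "(v + 2) choose v = (v + 2) choose 2" by (subst binomial_symmetric) auto
      then show ?thesis by (simp add: A1_def quad_coeff_def minus_one_gchoose e B_def add_ac)
    qed
    have A2: "A2 = of_int (- e * int (v + 2) - C)"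
    proof -
      have "(v + 2) choose (v - 1) = (v + 2) choose 3" using v(2) by (subst binomial_symmetric) auto
      moreover have "(- 1 :: complex) ^ (v - 1) = - of_int e"
        unfolding e(1)[symmetric] using v(2) by (cases v) auto
      ultimately show ?thesis
        by (simp add: A2_def quad_coeff_def minus_one_gchoose C_def add_ac)
    qed
    have C6: "6 * C = int v * (int v + 1) * (int v + 2)"
      using arg_cong[OF choose_three_shift[of v], of int] by (simp add: C_def algebra_simps)
    have B2: "2 * B = (int v + 1) * (int v + 2)"
      using arg_cong[OF choose_two_shift[of v], of int] by (simp add: B_def algebra_simps)
    define k where "k = 2 * (- e * int (v + 2) - C) + 2 * int v - int v * (int v + 1) * (int v + 2)
      + N * M * M * (int v * (e + B) - (- e * int (v + 2) - C))"
    have "\<kappa> = of_int k" by (simp add: \<kappa>_def k_def A1 A2 n_def m_def)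
    moreover have "k < 0"
    proof -
      have v2: "int v \<ge> 2" using v(2) by simp
      have "int v * (int v + 2) \<ge> 2 * 4" using v(2) by (intro mult_mono) auto
      then have "(int v + 1) * 8 \<le> (int v + 1) * (int v * (int v + 2))" by (intro mult_left_mono) auto
      then have C: "4 * int v + 4 \<le> 3 * C" using C6 by (simp add: algebra_simps)
      have "(int v + 1) * (int v + 2) \<ge> 3 * 4" using v(2) by (intro mult_mono) auto
      then have "int v * B \<ge> int v * 6" using B2 by (intro mult_left_mono) auto
      moreover have "e * (2 * int v + 2) \<ge> - (2 * int v + 2)" using e(2) by auto
      moreover have "int v * (e + B) - (- e * int (v + 2) - C) = int v * B + C + e * (2 * int v + 2)"
        by (simp add: algebra_simps)
      moreover have "q + C + r > 0" if "int v * 6 \<le> q" "- (2 * int v + 2) \<le> r" for q r :: int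
        using that C v2 by linarith
      ultimately have "int v * (e + B) - (- e * int (v + 2) - C) > 0" by (simp only:)
      moreover have "N * M * M < 0" using assms(1,2) by (simp add: mult_neg_pos)
      ultimately have "N * M * M * (int v * (e + B) - (- e * int (v + 2) - C)) < 0"
        by (rule mult_neg_pos[rotated])
      moreover have "2 * (- e * int (v + 2) - C) + 2 * int v - int v * (int v + 1) * (int v + 2) < 0"
        using C v(2) e(2) unfolding C6[symmetric] by (auto simp: algebra_simps)
      ultimately show ?thesis unfolding k_def by linarith
    qed
    ultimately show ?thesis by simp
  qed
  then have "n * m * \<kappa> \<noteq> 0" using assms by (simp add: n_def m_def)
  with * show ?thesis unfolding X_def by (rule csub_cscale_cancel[OF csub_KC2])
qed

section \<open>Reduction of monomials by their length\<close>

lemma quadratic_leading_relation: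
  assumes "0 < a" "0 < b" "\<rho> \<in> zero_free"
    and lower: "\<And>\<mu>. \<mu> \<in> zero_free \<Longrightarrow> sum_mset \<mu> = Suc (a + b + sum_mset \<rho>) \<Longrightarrow> size \<mu> < size \<rho> + 2
       \<Longrightarrow> mono \<mu> \<in> KC2 N M"
  shows "cscale (of_nat a) (mono (add_mset (Suc a) (add_mset b \<rho>)))
     + cscale (of_nat b) (mono (add_mset a (add_mset (Suc b) \<rho>))) \<in> KC2 N M"
proof -
  have main: "cscale (of_nat i) (xvar (Suc i) * xvar j * mono \<rho>) + cscale (of_nat j) (xvar i * xvar (Suc j) * mono \<rho>) \<in> KC2 N M"
    (is "?L \<in> _") if ij: "0 < i" "i \<le> j" "i + j = a + b" for i j
  proof -
    let ?R = "cscale (of_int N * of_int M * quad_coeff i j 0) (xvar (Suc (i + j)) * mono \<rho>)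
    + (\<Sum>m\<in>set_mset \<rho>. cscale (of_int N * of_nat m * of_nat (count \<rho> m) * quad_coeff i j m)
         (xvar (Suc (i + j + m)) * mono (\<rho> - {#m#})))"
    \<comment> \<open>The zero-mode term is shorter than the leading terms by one and each
      contraction by two, all of the same weight, so \<open>lower\<close> applies.\<close>
    have "?R \<in> KC2 N M"
    proof (intro csub_add csub_KC2 csub_sum csub_cscale)
      show "xvar (Suc (i + j)) * mono \<rho> \<in> KC2 N M"
        unfolding mono_add_mset[symmetric] using assms(3) ij by (intro lower) auto
      fix m assume m: "m \<in># \<rho>"
      show "xvar (Suc (i + j + m)) * mono (\<rho> - {#m#}) \<in> KC2 N M"
        unfolding mono_add_mset[symmetric]
      proof (rule lower)
        show "add_mset (Suc (i + j + m)) (\<rho> - {#m#}) \<in> zero_free"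
          using assms(3) by (simp add: zero_free_diff)
        show "sum_mset (add_mset (Suc (i + j + m)) (\<rho> - {#m#})) = Suc (a + b + sum_mset \<rho>)"
          using sum_mset.remove[OF m] ij unfolding sum_mset.add_mset by linarith
        show "size (add_mset (Suc (i + j + m)) (\<rho> - {#m#})) < size \<rho> + 2"
          using m by (simp add: size_Diff_singleton)
      qed
    qed
    moreover have "?L + ?R \<in> KC2 N M"
      using quadratic_relation[OF ij(1,2) assms(3), of N M] by (simp add: add.assoc)
    ultimately show ?thesis using csub_diff[OF csub_KC2, of "?L + ?R" N M ?R] by (simp add: add_diff_cancel_right')
  qed
  show ?thesis
  proof (cases "a \<le> b")
    case True
    from main[OF assms(1) this refl] show ?thesis by (simp add: mono_add_mset mult.assoc)
  next
    case False
    then have "b \<le> a" by simp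
    from main[OF assms(2) this add.commute] show ?thesis by (simp add: mono_add_mset mult_ac add_ac)
  qed
qed

text \<open>Every relation used preserves the weight, so the bound 5 survives the induction on the
  length, whose base is \<open>xvar_in_KC2\<close>. In a longer monomial weight is moved from one
  variable to another until x_1 appears.\<close>

lemma mono_in_KC2:
  assumes "N < 0" "M > 0" "\<mu> \<in> zero_free" "sum_mset \<mu> \<ge> 5"
  shows "mono \<mu> \<in> KC2 N M"
  using assms(3,4)
proof (induction "size \<mu>" arbitrary: \<mu> rule: less_induct)
  case less
  have lower: "mono \<nu> \<in> KC2 N M" if "\<nu> \<in> zero_free" "sum_mset \<nu> = sum_mset \<mu>" "size \<nu> < size \<mu>" for \<nu>
    using less that by simp
  \<comment> \<open>\<open>b\<close> is arbitrary in this induction because it takes up the weight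
    that \<open>a\<close> gives away.\<close>
  have pair: "mono (add_mset a (add_mset b \<rho>)) \<in> KC2 N M"
    if "0 < a" "0 < b" "\<rho> \<in> zero_free" "a + b + sum_mset \<rho> = sum_mset \<mu>" "size \<rho> + 2 = size \<mu>" for a b \<rho>
    using that
  proof (induction a arbitrary: b)
    case (Suc a)
    show ?case
    proof (cases "a = 0")
      case True
      let ?\<nu> = "add_mset b \<rho>"
      have "transl ?\<nu> + cscale (of_int M) (xvar 1 * mono ?\<nu>) \<in> KC2 N M"
        using Suc.prems by (intro translation_relation) simp
      \<comment> \<open>Translation keeps the length of \<open>?\<nu>\<close>, which is one less
        than that of \<mu>.\<close>
      moreover have "transl ?\<nu> \<in> KC2 N M"
      proof -
        have "of_nat m * xvar (Suc m) * mono (?\<nu> - {#m#}) \<in> KC2 N M" if m: "m \<in># ?\<nu>" for m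
        proof -
          have "mono (add_mset (Suc m) (?\<nu> - {#m#})) \<in> KC2 N M"
          proof (rule lower)
            show "add_mset (Suc m) (?\<nu> - {#m#}) \<in> zero_free"
              using Suc.prems by (simp add: zero_free_diff)
            have "sum_mset ?\<nu> = m + sum_mset (?\<nu> - {#m#})" using m by (rule sum_mset.remove)
            then show "sum_mset (add_mset (Suc m) (?\<nu> - {#m#})) = sum_mset \<mu>"
              using Suc.prems(4) True unfolding sum_mset.add_mset by linarith
            show "size (add_mset (Suc m) (?\<nu> - {#m#})) < size \<mu>"
              using m Suc.prems(5) by (simp add: size_Diff_singleton)
          qed
          from csub_cscale[OF csub_KC2 this, of "of_nat m"] show ?thesis
            by (simp add: mono_add_mset cscale_m1 cnst_of_nat mult.assoc)
        qed
        then have "set_mset \<sigma> \<subseteq> set_mset ?\<nu> \<Longrightarrow> (\<Sum>m\<in>#\<sigma>. of_nat m * xvar (Suc m) * mono (?\<nu> - {#m#})) \<in> KC2 N M" for \<sigma>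
          by (induction \<sigma>) (auto intro!: csub_0 csub_add csub_KC2)
        then show ?thesis unfolding transl_def by blast
      qed
      ultimately have "cscale (of_int M) (xvar 1 * mono ?\<nu>) \<in> KC2 N M"
        using csub_diff[OF csub_KC2, of "transl ?\<nu> + cscale (of_int M) (xvar 1 * mono ?\<nu>)" N M "transl ?\<nu>"] by simp
      then have "xvar 1 * mono ?\<nu> \<in> KC2 N M"
        by (rule csub_cscale_cancel[OF csub_KC2]) (use assms(2) in simp)
      then show ?thesis using True by (simp add: mono_add_mset)
    next
      case False
      have IH: "mono (add_mset a (add_mset (Suc b) \<rho>)) \<in> KC2 N M"
        using Suc.prems False by (intro Suc.IH) auto
      have lead: "cscale (of_nat a) (mono (add_mset (Suc a) (add_mset b \<rho>)))
          + cscale (of_nat b) (mono (add_mset a (add_mset (Suc b) \<rho>))) \<in> KC2 N M"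
        using Suc.prems False by (intro quadratic_leading_relation lower) auto
      from csub_diff[OF csub_KC2 lead csub_cscale[OF csub_KC2 IH, of "of_nat b"]]
      have "cscale (of_nat a) (mono (add_mset (Suc a) (add_mset b \<rho>))) \<in> KC2 N M" by simp
      then show ?thesis by (rule csub_cscale_cancel[OF csub_KC2]) (use False in simp)
    qed
  qed simp
  show ?case
  proof (cases \<mu>)
    case empty
    then show ?thesis using less.prems by simp
  next
    case (add a \<nu>)
    show ?thesis
    proof (cases \<nu>)
      case empty
      then show ?thesis using add less.prems xvar_in_KC2[OF assms(1,2), of a] by (simp add: xvar_def)
    next
      case (add b \<rho>)
      then show ?thesis using \<open>\<mu> = add_mset a \<nu>\<close> less.prems pair[of a b \<rho>] by (simp add: add_ac)
    qed
  qed
qed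

lemma high_in_KC2:
  assumes "N < 0" "M > 0" "P \<in> supp (zero_free \<inter> {\<mu>. 5 \<le> sum_mset \<mu>})"
  shows "P \<in> KC2 N M"
proof -
  have "linex (\<lambda>\<mu>. Poly_Mapping.single \<mu> 1) P \<in> KC2 N M"
    using assms(3) by (intro csub_linex csub_KC2)
      (auto simp flip: mono_def intro!: mono_in_KC2[OF assms(1,2)] dest: supp_keysD)
  then show ?thesis by (simp add: linex_singles)
qed

section \<open>Coefficients of polynomial families\<close>

text \<open>The combination $f(2m) - 2^d f(m)$ kills the leading coefficient of a polynomial of degree $d$.\<close>

lemma power_sum_coeffs_in_csub:
  assumes "csub K" "\<And>m. m \<ge> m0 \<Longrightarrow> (\<Sum>j\<le>d. cscale (of_nat m ^ j) (v j)) \<in> K" "j \<le> d"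
  shows "v j \<in> K"
  using assms(2,3)
proof (induction d arbitrary: v j)
  case 0
  then show ?case using "0.prems"(1)[of m0] by simp
next
  case (Suc d)
  let ?f = "\<lambda>m. \<Sum>j\<le>Suc d. cscale (of_nat m ^ j) (v j)"
  have low: "v j \<in> K" if "j \<le> d" for j
  proof -
    have "cscale (2 ^ j - 2 ^ Suc d) (v j) \<in> K"
    proof (rule Suc.IH[OF _ that])
      fix m assume m: "m \<ge> m0"
      have "(\<Sum>j\<le>d. cscale (of_nat m ^ j) (cscale (2 ^ j - 2 ^ Suc d) (v j))) = ?f (2 * m) + cscale (- (2 ^ Suc d)) (?f m)"
        by (rule poly_mapping_eqI)
           (simp add: lookup_add lookup_sum algebra_simps power_mult_distrib sum_distrib_left sum_distrib_right sum_subtractf sum_negf)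
      also have "\<dots> \<in> K" using m by (intro csub_add csub_cscale assms(1) Suc.prems(1)) auto
      finally show "(\<Sum>j\<le>d. cscale (of_nat m ^ j) (cscale (2 ^ j - 2 ^ Suc d) (v j))) \<in> K" .
    qed
    moreover have "(2 :: complex) ^ j - 2 ^ Suc d \<noteq> 0"
    proof -
      have "(2 :: nat) ^ j \<noteq> 2 ^ Suc d" using that by (simp del: power_Suc)
      then have "(of_nat (2 ^ j) :: complex) \<noteq> of_nat (2 ^ Suc d)" unfolding of_nat_eq_iff .
      then show ?thesis by simp
    qed
    ultimately show ?thesis by (rule csub_cscale_cancel[OF assms(1)])
  qed
  show ?case
  proof (cases "j \<le> d")
    case False
    then have "j = Suc d" using Suc.prems by simp
    \<comment> \<open>The value at \<open>Suc m0\<close> is taken because m0 may be 0, where the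
      leading term vanishes.\<close>
    have "(\<Sum>j\<le>d. cscale (of_nat (Suc m0) ^ j) (v j)) \<in> K"
      by (intro csub_sum csub_cscale assms(1) low) simp
    from csub_diff[OF assms(1) Suc.prems(1)[of "Suc m0"] this]
    have "cscale (of_nat (Suc m0) ^ Suc d) (v (Suc d)) \<in> K"
      by (simp del: of_nat_Suc power_Suc)
    then show ?thesis unfolding \<open>j = Suc d\<close>
      by (rule csub_cscale_cancel[OF assms(1)]) (simp del: of_nat_Suc)
  qed (simp add: low)
qed

lemma poly_coeff_in_csub:
  fixes p :: "m1 poly"
  assumes "csub K" "\<And>m. m \<ge> m0 \<Longrightarrow> poly p (of_nat m) \<in> K"
  shows "coeff p j \<in> K"
proof (cases "j \<le> degree p")
  case True
  show ?thesis
  proof (rule power_sum_coeffs_in_csub[OF assms(1) _ True])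
    fix m assume "m \<ge> m0"
    from assms(2)[OF this] show "(\<Sum>j\<le>degree p. cscale (of_nat m ^ j) (coeff p j)) \<in> K"
      by (simp add: poly_altdef cscale_m1 cnst_power cnst_of_nat mult.commute)
  qed
next
  case False
  then show ?thesis by (simp add: coeff_eq_0 csub_0[OF assms(1)])
qed

text \<open>A family polynomial in m with coefficients in M(1), recorded through its two lowest
  coefficients: the constant one settles b > 0 and the linear one b = 0.\<close>

definition poly_jet :: "(nat \<Rightarrow> m1) \<Rightarrow> m1 \<Rightarrow> m1 \<Rightarrow> bool" where
  "poly_jet f a0 a1 \<longleftrightarrow> (\<exists>p. (\<forall>m. f m = poly p (of_nat m)) \<and> coeff p 0 = a0 \<and> coeff p 1 = a1)"

lemma poly_jet_in_csub:
  assumes "csub K" "poly_jet f a0 a1" "\<And>m. m \<ge> m0 \<Longrightarrow> f m \<in> K"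
  shows "a0 \<in> K" "a1 \<in> K"
  using assms poly_coeff_in_csub[OF assms(1), of m0] unfolding poly_jet_def by metis+

lemma poly_jet_monom:
  "poly_jet (\<lambda>m. of_nat m ^ j * a) (if j = 0 then a else 0) (if j = 1 then a else 0)"
  unfolding poly_jet_def by (intro exI[of _ "monom a j"]) (auto simp: poly_monom mult.commute)

lemma poly_jet_const: "poly_jet (\<lambda>m. a) a 0"
  using poly_jet_monom[of 0 a] by simp

lemma poly_jet_id: "poly_jet of_nat 0 1"
  using poly_jet_monom[of 1 1] by simp

lemma poly_jet_add:
  "poly_jet f a0 a1 \<Longrightarrow> poly_jet g b0 b1 \<Longrightarrow> poly_jet (\<lambda>m. f m + g m) (a0 + b0) (a1 + b1)"
  unfolding poly_jet_def by (elim exE, rule exI, auto intro: poly_add[symmetric])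

lemma poly_jet_mult:
  assumes "poly_jet f a0 a1" "poly_jet g b0 b1"
  shows "poly_jet (\<lambda>m. f m * g m) (a0 * b0) (a0 * b1 + a1 * b0)"
proof -
  obtain p q where "\<forall>m. f m = poly p (of_nat m)" "coeff p 0 = a0" "coeff p 1 = a1"
    "\<forall>m. g m = poly q (of_nat m)" "coeff q 0 = b0" "coeff q 1 = b1"
    using assms unfolding poly_jet_def by blast
  then show ?thesis unfolding poly_jet_def
    by (intro exI[of _ "p * q"]) (simp add: coeff_mult mult.commute)
qed

lemma poly_jet_sum:
  "(\<And>i. i \<in> A \<Longrightarrow> poly_jet (f i) (a0 i) (a1 i)) \<Longrightarrow> poly_jet (\<lambda>m. \<Sum>i\<in>A. f i m) (sum a0 A) (sum a1 A)"
  by (induction A rule: infinite_finite_induct) (auto intro: poly_jet_add poly_jet_const)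

lemma poly_jet_cong: "poly_jet f a0 a1 \<Longrightarrow> (\<And>m. f m = g m) \<Longrightarrow> a0 = b0 \<Longrightarrow> a1 = b1 \<Longrightarrow> poly_jet g b0 b1"
  by (simp add: poly_jet_def)

text \<open>The projection is not multiplicative, but it may be applied to each coefficient because
  m enters as a scalar.\<close>

lemma poly_jet_wproj:
  assumes "poly_jet f a0 a1"
  shows "poly_jet (\<lambda>m. wproj W (f m)) (wproj W a0) (wproj W a1)"
proof -
  obtain p where p: "\<forall>m. f m = poly p (of_nat m)" "coeff p 0 = a0" "coeff p 1 = a1"
    using assms unfolding poly_jet_def by blast
  let ?q = "map_poly (wproj W) p"
  have c: "coeff ?q n = wproj W (coeff p n)" for n by (simp add: coeff_map_poly clin_0[OF clin_wproj])
  have dq: "degree ?q \<le> degree p"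
    by (rule degree_le) (simp add: c coeff_eq_0 clin_0[OF clin_wproj])
  have "wproj W (f m) = poly ?q (of_nat m)" for m
  proof -
    have "f m = (\<Sum>i\<le>degree p. cscale (of_nat m ^ i) (coeff p i))"
      using p by (simp add: poly_altdef cscale_m1 cnst_power cnst_of_nat mult.commute)
    then have "wproj W (f m) = (\<Sum>i\<le>degree p. cscale (of_nat m ^ i) (wproj W (coeff p i)))"
      by (simp only: clin_sum[OF clin_wproj] clin_cscale[OF clin_wproj])
    then have "wproj W (f m) = (\<Sum>i\<le>degree p. of_nat m ^ i * coeff ?q i)"
      by (simp add: c cscale_m1 cnst_power cnst_of_nat)
    also have "\<dots> = poly ?q (of_nat m)"
      unfolding poly_altdef
      using dq by (intro sum.mono_neutral_cong_right) (auto simp: coeff_eq_0 mult.commute)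
    finally show ?thesis .
  qed
  then show ?thesis unfolding poly_jet_def using p c by auto
qed

text \<open>The linear coefficient may stay unknown: the binomial is later multiplied by a family
  without constant term.\<close>

lemma poly_jet_gchoose:
  fixes g :: "nat \<Rightarrow> complex"
  assumes "poly_jet (\<lambda>m. cnst (g m)) (cnst c0) c1"
  shows "\<exists>d1. poly_jet (\<lambda>m. cnst (g m gchoose i)) (cnst (c0 gchoose i)) d1"
proof -
  have "\<exists>d1. poly_jet (\<lambda>m. cnst (\<Prod>l<i. g m - of_nat l)) (cnst (\<Prod>l<i. c0 - of_nat l)) d1"
  proof (induction i)
    case 0
    then show ?case using poly_jet_const[of 1] by auto
  next
    case (Suc i)
    then obtain d1 where "poly_jet (\<lambda>m. cnst (\<Prod>l<i. g m - of_nat l)) (cnst (\<Prod>l<i. c0 - of_nat l)) d1" by blast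
    from poly_jet_mult[OF this poly_jet_add[OF assms poly_jet_const[of "cnst (- of_nat i)"]]]
    show ?case by (auto simp flip: cnst_mult cnst_add)
  qed
  then obtain d1 where "poly_jet (\<lambda>m. cnst (\<Prod>l<i. g m - of_nat l)) (cnst (\<Prod>l<i. c0 - of_nat l)) d1" by blast
  from poly_jet_mult[OF this poly_jet_const[of "cnst (1 / fact i)"]]
  show ?thesis by (auto simp: gbinomial_prod_rev atLeast0LessThan simp flip: cnst_mult)
qed

section \<open>The charge lowering relation\<close>

lemma wproj_low:
  assumes "f \<in> supp {\<mu>. sum_mset \<mu> \<le> w}" "int w < W"
  shows "wproj W f = 0"
proof -
  have "wproj W f \<in> supp {}"
    using assms(2) by (intro supp_mono[OF _ supp_wproj[OF assms(1)]]) auto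
  then show ?thesis by (simp add: supp_def)
qed

text \<open>The exponent is -m times a fixed polynomial, so the truncated exponential has degree at
  most W in m.\<close>

lemma exp_op_poly_jet:
  "poly_jet (\<lambda>m. exp_op (- int m) W) 1 (- (\<Sum>j\<in>{1..W}. cscale (1 / of_nat j) (xvar j)))"
proof -
  define e where "e = (\<Sum>j\<in>{1..W}. cscale (1 / of_nat j) (xvar j))"
  define c where "c j = cscale (1 / of_nat (fact j)) ((- e) ^ j)" for j
  have "exp_op (- int m) W = (\<Sum>j\<in>{0..W}. of_nat m ^ j * c j)" for m
  proof -
    have *: "(\<Sum>i\<in>{1..W}. cscale (of_int (- int m) / of_nat i) (xvar i)) = of_nat m * (- e)"
      by (simp add: e_def sum_distrib_left cscale_m1 cnst_minus divide_inverse cnst_mult cnst_of_nat mult.assoc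
          flip: sum_negf)
    show ?thesis
      unfolding exp_op_def c_def * power_mult_distrib by (simp add: cscale_m1 mult_ac)
  qed
  moreover have "(\<Sum>j\<in>{0..W}. if j = 0 then c j else 0) = 1"
    by (simp add: c_def)
  \<comment> \<open>For W = 0 the truncation has no linear term, in agreement with the empty sum
    e.\<close>
  moreover have "(\<Sum>j\<in>{0..W}. if j = 1 then c j else 0) = - e"
    by (cases W) (simp_all add: c_def e_def)
  ultimately show ?thesis
    using poly_jet_sum[of "{0..W}" "\<lambda>j m. of_nat m ^ j * c j", OF poly_jet_monom] by (simp add: e_def)
qed

text \<open>For the linear coefficient a weight bound is enough: where it has to vanish, it is
  projected to a strictly larger weight.\<close>

lemma shift_op_poly_jet:
  "\<exists>s \<in> supp {\<mu>. sum_mset \<mu> \<le> sum_mset R}. poly_jet (\<lambda>m. shift_op N (- int m) (mono R)) (mono R) s"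
  unfolding shift_op_mono
proof (induction R)
  case empty
  then show ?case using poly_jet_const[of 1] csub_0[OF csub_supp] by auto
next
  case (add i R)
  then obtain s where s: "s \<in> supp {\<mu>. sum_mset \<mu> \<le> sum_mset R}"
    "poly_jet (\<lambda>m. \<Prod>i\<in>#R. xvar i + cnst (- of_int (N * - int m))) (mono R) s" by blast
  have "poly_jet (\<lambda>m. xvar i + of_nat m * cnst (of_int N)) (xvar i + 0) (0 + cnst (of_int N))"
    using poly_jet_monom[of 1] by (intro poly_jet_add poly_jet_const) simp
  then have "poly_jet (\<lambda>m. xvar i + cnst (- of_int (N * - int m))) (xvar i) (cnst (of_int N))"
    by (rule poly_jet_cong) (simp_all add: cnst_mult cnst_of_nat mult.commute)
  from poly_jet_mult[OF this s(2)]
  have "poly_jet (\<lambda>m. \<Prod>i\<in>#add_mset i R. xvar i + cnst (- of_int (N * - int m))) (mono (add_mset i R))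
      (xvar i * s + cnst (of_int N) * mono R)"
    by (simp add: mono_add_mset)
  moreover have "xvar i * s \<in> supp {\<mu>. sum_mset \<mu> \<le> sum_mset (add_mset i R)}"
    using homog_xvar[of i] s(1) unfolding homog_def by (rule supp_mult) auto
  moreover have "cscale (of_int N) (mono R) \<in> supp {\<mu>. sum_mset \<mu> \<le> sum_mset (add_mset i R)}"
    by (intro csub_cscale csub_supp supp_mono_poly) simp
  ultimately show ?case by (auto simp: cscale_m1 intro: csub_add csub_supp)
qed

text \<open>The weight W part of E^- E^+ for e^{-m\<alpha>}, applied to the monomial R.\<close>

definition lowered :: "int \<Rightarrow> nat \<Rightarrow> nat multiset \<Rightarrow> nat \<Rightarrow> m1" where
  "lowered N W R m = wproj (int W) (exp_op (- int m) W * shift_op N (- int m) (mono R))"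

text \<open>At m = 0 both exponential factors are the identity, which gives the constant
  coefficient.\<close>

lemma lowered_poly_jet_same:
  "\<exists>a1. poly_jet (lowered N (sum_mset R) R) (mono R) a1"
proof -
  obtain s where "poly_jet (\<lambda>m. shift_op N (- int m) (mono R)) (mono R) s"
    using shift_op_poly_jet by blast
  from poly_jet_wproj[OF poly_jet_mult[OF exp_op_poly_jet this], of "int (sum_mset R)" "sum_mset R"]
  show ?thesis unfolding lowered_def[abs_def] by (auto simp: wproj_mono)
qed

text \<open>To first order in m either the shift or the exponential acts. The shift cannot raise the
  weight, so the missing weight i is supplied by the term -x_i / i of the exponential.\<close>

lemma lowered_poly_jet_remove:
  assumes "i > 0"
  shows "poly_jet (lowered N (i + sum_mset R) R) 0 (cscale (- 1 / of_nat i) (mono (add_mset i R)))"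
proof -
  let ?W = "i + sum_mset R"
  let ?e = "\<Sum>j\<in>{1..?W}. cscale (1 / of_nat j) (xvar j)"
  obtain s where s: "s \<in> supp {\<mu>. sum_mset \<mu> \<le> sum_mset R}"
    "poly_jet (\<lambda>m. shift_op N (- int m) (mono R)) (mono R) s"
    using shift_op_poly_jet by blast
  have "wproj (int ?W) s = 0" using s(1) by (rule wproj_low) (use assms in simp)
  moreover have "wproj (int ?W) (- ?e * mono R) = cscale (- 1 / of_nat i) (mono (add_mset i R))"
  proof -
    have "wproj (int ?W) (?e * mono R) = (\<Sum>j\<in>{1..?W}. cscale (1 / of_nat j) (wproj (int ?W) (mono (add_mset j R))))"
      by (simp only: sum_distrib_right clin_sum[OF clin_wproj] cscale_mult_left clin_cscale[OF clin_wproj] mono_add_mset)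
    also have "\<dots> = (\<Sum>j\<in>{1..?W}. if j = i then cscale (1 / of_nat j) (mono (add_mset j R)) else 0)"
      by (rule sum.cong) (auto simp: wproj_mono)
    also have "\<dots> = cscale (1 / of_nat i) (mono (add_mset i R))" using assms by simp
    finally show ?thesis
      by (simp add: clin_minus[OF clin_wproj] cscale_m1 cnst_minus)
  qed
  moreover have "wproj (int ?W) (mono R) = 0" using assms by (simp add: wproj_mono)
  ultimately show ?thesis
    by (intro poly_jet_cong[OF poly_jet_wproj[OF poly_jet_mult[OF exp_op_poly_jet s(2)], of "int ?W" ?W]])
       (simp_all only: lowered_def mult_1_left clin_add[OF clin_wproj] add_0_left)
qed

text \<open>Moves the growing number l out of the lower index: for fixed i the right side is, up to
  sign, polynomial in l.\<close>

lemma gchoose_reflect: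
  "(- of_nat i - 1 :: complex) gchoose l = (- 1) ^ l * ((of_nat i + of_nat l) gchoose i)"
proof -
  have "(- (of_nat i + 1) :: complex) gchoose l = (- 1) ^ l * ((of_nat i + 1 + of_nat l - 1) gchoose l)"
    by (rule gbinomial_minus)
  also have "(of_nat i + 1 + of_nat l - 1 :: complex) = of_nat (i + l)" by simp
  also have "(of_nat (i + l) :: complex) gchoose l = of_nat (i + l) gchoose i"
    using binomial_symmetric[of l "i + l"] by (simp add: binomial_gbinomial[symmetric] del: of_nat_add)
  finally show ?thesis by simp
qed

text \<open>All creation coefficients \<open>(m - 1) choose (n - 1)\<close> with m <= W vanish since
  W < n, so the field of x_n only annihilates.\<close>

lemma modeP_single:
  assumes "int (sum_mset \<nu>) + int n - N * b * c + 1 = int W" "W < n"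
  shows "modeP N {#n#} b (- 2) \<nu> c = wproj (int W) (exp_op b W * shift_op N b (ann_op N c n (mono \<nu>)))"
proof -
  have W: "int (sum_mset \<nu>) + int (sum_mset {#n#}) - N * b * c - (- 2) - 1 = int W" using assms(1) by simp
  have ns: "sorted_list_of_multiset {#n#} = [n]" by simp
  have P: "Pow {..<1::nat} = {{}, {0}}" by (auto simp: lessThan_Suc Pow_insert)
  have "cre_op n W = 0"
    unfolding cre_op_def
  proof (intro sum.neutral ballI)
    fix m assume "m \<in> {1..W}"
    then have *: "(of_nat ((m - 1) choose (n - 1)) :: complex) = 0"
      using assms(2) unfolding of_nat_eq_0_iff binomial_eq_0_iff by auto
    show "cscale (of_nat ((m - 1) choose (n - 1))) (xvar m) = 0" unfolding * by simp
  qed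
  then show ?thesis
    unfolding modeP_def Let_def W ns by (simp add: P[simplified] clin_0[OF clin_wproj])
qed

text \<open>Annihilation removes a factor x_i from Q and the linear term of the exponential puts it
  back, so for b = 0 the coefficient of m is again a multiple of Q.\<close>

lemma charge_lowering:
  fixes k b :: int
  assumes "k > 0" "b \<ge> 0" "Q \<in> zero_free"
  shows "mono Q \<in> KC2 (- 2 * k) b"
proof -
  define N where "N = - 2 * k"
  define W where "W = sum_mset Q"
  \<comment> \<open>\<open>g i m\<close> is binom(n - 1 + i, i) for n - 1 = 2 k m (m + b) - 2, and
    \<open>F m\<close> below is the component of charge b divided by (-1)^(n-1) N.\<close>
  define g where "g i m = (of_nat i - 2 + 2 * of_int k * of_nat m * (of_nat m + of_int b) :: complex) gchoose i" for i m
  define F where "F m = cscale (of_nat m + of_int b) (lowered N W Q m)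
    + (\<Sum>i\<in>set_mset Q. cscale (g i m * of_nat i * of_nat (count Q i)) (lowered N W (Q - {#i#}) m))" for m
  have N: "N < 0" using assms(1) by (simp add: N_def)
  have pos: "{i \<in> set_mset Q. 1 \<le> i} = set_mset Q"
    using assms(3) by (auto simp: zero_free_def Suc_le_eq) (metis gr0I)
  \<comment> \<open>The bound on m yields k m (m + b) >= 2 m, hence n >= 4 m - 1, which exceeds both
    W and 6.\<close>
  have in_K: "F m \<in> KC2 N b" if m: "m \<ge> W + 2" for m
  proof -
    define c where "c = int m + b"
    define n where "n = nat (2 * k * int m * c - 1)"
    have "int m * int m \<le> k * (int m * c)"
    proof -
      have "int m * int m \<le> int m * c" using assms(2) by (intro mult_left_mono) (auto simp: c_def)
      also have "\<dots> = 1 * (int m * c)" by simp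
      also have "\<dots> \<le> k * (int m * c)" using assms(1,2) by (intro mult_right_mono) (auto simp: c_def)
      finally show ?thesis .
    qed
    moreover have "int m * 2 \<le> int m * int m" using m by (intro mult_left_mono) auto
    ultimately have ge: "2 * int m \<le> k * (int m * c)" by linarith
    have eq: "2 * k * int m * c = 2 * (k * (int m * c))" by simp
    have "0 \<le> 2 * k * int m * c - 1" unfolding eq using ge m by linarith
    then have n: "int n = 2 * k * int m * c - 1" unfolding n_def by simp
    have nW: "W < n" "n \<ge> 7" using n[unfolded eq] ge m by linarith+
    \<comment> \<open>This component has positive charge 2m+b and weight W + 4 k m (m + b), which is
      at least 5.\<close>
    have "modeP N {#n#} (int m) (- 2) Q c \<in> KC2 N (int m + c)"
    proof (rule high_in_KC2[OF N])
      show "0 < int m + c" using m assms(2) by (simp add: c_def)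
      have e: "N * int m * c = - (2 * (k * (int m * c)))" by (simp add: N_def)
      have "5 \<le> int (sum_mset Q) + int n - N * int m * c - (- 2) - 1"
        unfolding e using nW(2) ge m by linarith
      then show "modeP N {#n#} (int m) (- 2) Q c \<in> supp (zero_free \<inter> {\<mu>. 5 \<le> sum_mset \<mu>})"
        by (intro supp_mono[OF _ supp_modeP[OF assms(3)]]) auto
    qed
    then have "modeP N {#n#} (- int m) (- 2) Q c \<in> KC2 N (c - int m)"
      using nW assms(3) by (intro modeP_transfer) auto
    moreover have "modeP N {#n#} (- int m) (- 2) Q c =
      wproj (int W) (exp_op (- int m) W * shift_op N (- int m) (ann_op N c n (mono Q)))"
      by (rule modeP_single) (use n nW in \<open>simp_all add: N_def W_def\<close>)
    moreover have "\<dots> = cscale ((- 1) ^ (n - 1) * of_int N) (F m)"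
    proof -
      have "(of_nat (n - 1) :: complex) = of_int (int (n - 1))" by simp
      also have "int (n - 1) = 2 * k * int m * c - 2" using n nW by simp
      finally have n1: "(of_nat (n - 1) :: complex) = 2 * of_int k * of_nat m * (of_nat m + of_int b) - 2"
        by (simp add: c_def)
      have g: "(- of_nat i - 1) gchoose (n - 1) = (- 1) ^ (n - 1) * g i m" for i
        unfolding gchoose_reflect n1 g_def by (simp add: algebra_simps)
      have ann: "ann_op N c n (mono Q) = cscale ((- 1) ^ (n - 1) * of_int N)
        (cscale (of_nat m + of_int b) (mono Q)
         + (\<Sum>i\<in>set_mset Q. cscale (g i m * of_nat i * of_nat (count Q i)) (mono (Q - {#i#}))))"
        unfolding ann_op_mono g pos minus_one_gchoose cscale_add cscale_sum cscale_cscale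
        by (simp add: c_def mult_ac)
      show ?thesis
        unfolding ann F_def lowered_def clin_cscale[OF clin_shift_op] clin_add[OF clin_shift_op]
          clin_sum[OF clin_shift_op] clin_cscale[OF clin_mult_right] distrib_left sum_distrib_left
          clin_cscale[OF clin_wproj] clin_add[OF clin_wproj] clin_sum[OF clin_wproj] ..
    qed
    ultimately have "cscale ((- 1) ^ (n - 1) * of_int N) (F m) \<in> KC2 N b" by (simp add: c_def)
    then show ?thesis by (rule csub_cscale_cancel[OF csub_KC2]) (use N in simp)
  qed
  obtain a1 where a1: "poly_jet (lowered N W Q) (mono Q) a1"
    using lowered_poly_jet_same W_def by blast
  have lin: "poly_jet (\<lambda>m. cnst (of_nat m + of_int b)) (cnst (of_int b)) 1"
    using poly_jet_add[OF poly_jet_id poly_jet_const[of "cnst (of_int b)"]] by (simp add: cnst_add cnst_of_nat)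
  have first: "poly_jet (\<lambda>m. cscale (of_nat m + of_int b) (lowered N W Q m))
      (cnst (of_int b) * mono Q) (cnst (of_int b) * a1 + mono Q)"
    using poly_jet_mult[OF lin a1] by (simp add: cscale_m1)
  \<comment> \<open>The family \<open>lowered\<close> without x_i starts with -m x_i / i, so of
    \<open>g i\<close> just the value at m = 0, binom(i-2, i), enters the linear
    coefficient.\<close>
  have rest: "poly_jet (\<lambda>m. cscale (g i m * of_nat i * of_nat (count Q i)) (lowered N W (Q - {#i#}) m))
     0 (cscale (- ((of_nat i - 2) gchoose i) * of_nat (count Q i)) (mono Q))" if i: "i \<in># Q" for i
  proof -
    have i0: "i > 0" using i assms(3) by (auto simp: zero_free_def intro: gr0I)
    have W: "i + sum_mset (Q - {#i#}) = W" unfolding W_def using i by (rule sum_mset.remove[symmetric])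
    have "poly_jet (\<lambda>m. cnst (of_nat i - 2 + 2 * of_int k * of_nat m * (of_nat m + of_int b)))
      (cnst (of_nat i - 2)) (cnst (2 * of_int k * of_int b))"
    proof -
      have "poly_jet (\<lambda>m. cnst (of_nat i - 2) + of_nat m ^ 1 * cnst (2 * of_int k) * cnst (of_nat m + of_int b))
        (cnst (of_nat i - 2) + 0 * cnst (of_int b)) (0 + (0 * 1 + cnst (2 * of_int k) * cnst (of_int b)))"
        using poly_jet_monom[of 1 "cnst (2 * of_int k)"] by (intro poly_jet_add poly_jet_const poly_jet_mult lin) simp
      then show ?thesis
        by (rule poly_jet_cong) (simp_all only: power_one_right cnst_add[of "of_nat i - 2"] cnst_mult cnst_of_nat mult_ac,
           simp_all add: mult_ac)
    qed
    from poly_jet_gchoose[OF this, of i] obtain d1 where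
      "poly_jet (\<lambda>m. cnst (g i m)) (cnst ((of_nat i - 2) gchoose i)) d1" unfolding g_def by blast
    from poly_jet_mult[OF poly_jet_mult[OF this poly_jet_const[of "cnst (of_nat i * of_nat (count Q i))"]]
        lowered_poly_jet_remove[OF i0, of N "Q - {#i#}"]]
    show ?thesis
      unfolding W
      by (rule poly_jet_cong) (use i i0 in \<open>simp_all add: cscale_m1 cnst_mult[symmetric] mult.assoc[symmetric]\<close>)
  qed
  have jet: "poly_jet F (cnst (of_int b) * mono Q) (cnst (of_int b) * a1 + mono Q
     + (\<Sum>i\<in>set_mset Q. cscale (- ((of_nat i - 2) gchoose i) * of_nat (count Q i)) (mono Q)))"
    unfolding F_def
    using poly_jet_add[OF first poly_jet_sum[OF rest]] by simp
  note coeffs = poly_jet_in_csub[OF csub_KC2 jet in_K]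
  have "mono Q \<in> KC2 N b"
  proof (cases "b = 0")
    case False
    have "cscale (of_int b) (mono Q) \<in> KC2 N b" using coeffs(1) by (simp add: cscale_m1)
    moreover have "(of_int b :: complex) \<noteq> 0" using False by simp
    ultimately show ?thesis by (rule csub_cscale_cancel[OF csub_KC2])
  next
    case True
    \<comment> \<open>As binom(i-2, i) is -1 for i = 1 and 0 for i >= 2, the contributions add to Q
      and cannot cancel it.\<close>
    have g0: "- ((of_nat i - 2) gchoose i) = (if i = 1 then 1 else 0 :: complex)" if i: "i \<in># Q" for i
    proof (cases "i = 1")
      case False
      then have "2 \<le> i" using i assms(3) by (cases i) (auto simp: zero_free_def)
      then have *: "(of_nat i - 2 :: complex) = of_nat (i - 2)" by simp
      have "(i - 2) choose i = 0" using \<open>2 \<le> i\<close> by (intro binomial_eq_0) simp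
      then show ?thesis unfolding * binomial_gbinomial[symmetric] by (simp only: False) simp
    qed simp
    have "(\<Sum>i\<in>set_mset Q. cscale (- ((of_nat i - 2) gchoose i) * of_nat (count Q i)) (mono Q))
        = (\<Sum>i\<in>set_mset Q. if i = 1 then cscale (of_nat (count Q 1)) (mono Q) else 0)"
      by (rule sum.cong) (auto simp: g0)
    also have "\<dots> = cscale (of_nat (count Q 1)) (mono Q)"
      by (auto simp: not_in_iff)
    finally have "cscale (1 + of_nat (count Q 1)) (mono Q) \<in> KC2 N b"
      using coeffs(2) True by (simp add: cscale_add_left)
    then show ?thesis
    proof (rule csub_cscale_cancel[OF csub_KC2])
      have "(1 + of_nat (count Q 1) :: complex) = of_nat (Suc (count Q 1))" by simp
      then show "(1 + of_nat (count Q 1) :: complex) \<noteq> 0" by (simp only: of_nat_eq_0_iff)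
    qed
  qed
  then show ?thesis by (simp add: N_def)
qed

theorem theorem4p5:
  fixes k :: int
  assumes "k > 0"
  shows "VLplus = C2 (-2 * k) VLplus"
  using C2_subset VLplus_subset_C2 charge_lowering[OF assms] by blast

end
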